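(* Let $r>1$ and $a$ be two real numbers. Suppose that $\mathsf{E}X=0$, $\mathsf{E}X^2=\sigma^2$ with $0<\sigma<\infty$, and $\mathsf{E}|X|^{2+\eta}<\infty$ for some $0<\eta<1$. Then for any eventually non-decreasing function $\psi:[1,\infty)\to(0,\infty)$, $$\sum_{n=1}^{\infty}n^{r-2}(\log n)^a\,\mathsf{P}\Big\{M_n\le\sigma\sqrt{\pi^2n/(8\psi(n))}\Big\}<\infty\ \text{ or }\ =\infty$$ according as $$\sum_{n=1}^{\infty}n^{r-2}(\log n)^a\exp\{-\psi(n)\}<\infty\ \text{ or }\ =\infty.$$
   Context: $X,X_1,X_2,\ldots$ are i.i.d. real random variables; $S_n=\sum_{k=1}^nX_k$ and $M_n=\max_{1\le k\le n}|S_k|$ for $n\ge1$. Convention: $\log x=\ln(\max(x,e))$. *)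

theory Defs
  imports "HOL-Probability.Probability"
begin

text \<open>The family is indexed by the positive integers; \<open>Xs 0\<close> is never used.
  Measurability of each \<open>Xs k\<close> is part of \<open>indep_vars\<close>.  The variable \<open>X\<close> is a generic
  copy that only carries the common law, so it need not be independent of the \<open>Xs k\<close>.\<close>

definition iid_copies :: "'a measure \<Rightarrow> ('a \<Rightarrow> real) \<Rightarrow> (nat \<Rightarrow> 'a \<Rightarrow> real) \<Rightarrow> bool" where
  "iid_copies M X Xs \<longleftrightarrow>
     X \<in> borel_measurable M \<and>
     prob_space.indep_vars M (\<lambda>_. borel) Xs {1..} \<and>
     (\<forall>k\<ge>1. distr M borel (Xs k) = distr M borel X)"

definition partial_sum :: "(nat \<Rightarrow> 'a \<Rightarrow> real) \<Rightarrow> nat \<Rightarrow> 'a \<Rightarrow> real" where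
  "partial_sum Xs n \<omega> = (\<Sum>k=1..n. Xs k \<omega>)"

text \<open>Only meaningful for \<open>n \<ge> 1\<close>, where the maximum is over a nonempty set.\<close>

definition max_abs_partial_sum :: "(nat \<Rightarrow> 'a \<Rightarrow> real) \<Rightarrow> nat \<Rightarrow> 'a \<Rightarrow> real" where
  "max_abs_partial_sum Xs n \<omega> = Max ((\<lambda>k. \<bar>partial_sum Xs k \<omega>\<bar>) ` {1..n})"

definition trunc_log :: "real \<Rightarrow> real" where
  "trunc_log x = ln (max x (exp 1))"

definition eventually_nondecreasing :: "(real \<Rightarrow> real) \<Rightarrow> bool" where
  "eventually_nondecreasing \<psi> \<longleftrightarrow> (\<exists>x0\<ge>1. mono_on {x0..} \<psi>)"

end

theory Submission
  imports Defs "HOL-Real_Asymp.Real_Asymp"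
begin

text \<open>The probability that the walk stays in \<open>{-b..b}\<close> up to time \<open>n\<close>, with
  \<open>b = \<sigma> sqrt (pi\<^sup>2 n / (8 p))\<close>, lies between constant multiples of \<open>exp (- p)\<close> uniformly for
  \<open>1 \<le> p \<le> n powr (\<eta> / 12)\<close>. For \<open>\<theta> = pi / (2 b)\<close> the function \<open>cos (\<theta> x)\<close> is an almost
  eigenfunction of the walk killed outside \<open>{-b..b}\<close>, with factor \<open>1 - \<theta>\<^sup>2 \<sigma>\<^sup>2 / 2 = 1 - p / n\<close>;
  the moment of order \<open>2 + \<eta>\<close> makes the error per step much smaller than \<open>1 / n\<close>.
  For the lower bound, adding \<open>\<epsilon> cos\<^sup>2\<close> with a small \<open>\<epsilon> > 0\<close> gives a genuine subsolution. For the
  upper bound, the strip is enlarged by the factor \<open>1 + 1 / p\<close>, so that the cosine stays of order at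
  least \<open>1 / p\<close> on \<open>{-b..b}\<close>; to avoid losing a factor \<open>p\<close> at the end, the last \<open>n / p\<close> steps
  are handled with \<open>cos - cos\<^sup>2 / 4\<close>, whose expectation drops by a fixed amount per step, which
  bounds the expected time spent in the strip. Values of \<open>p\<close> above \<open>n powr (\<eta> / 12)\<close> only contribute
  \<open>exp (- (n powr (\<eta> / 12)))\<close>, which is summable against the weights.\<close>

section \<open>Taylor bounds for sine and cosine with the exponent of the moment\<close>

lemma cos_quadratic_error:
  fixes t \<eta> :: real
  assumes "0 < \<eta>" "\<eta> < 1"
  shows "\<bar>cos t - (1 - t\<^sup>2 / 2)\<bar> \<le> \<bar>t\<bar> powr (2 + \<eta>)"
proof (cases "\<bar>t\<bar> \<le> 1")
  case True
  \<comment> \<open>For small \<open>t\<close> the expansion is taken to order four, because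
    \<open>t ^ 4\<close> lies below the power 2 + \<eta> there. For large \<open>t\<close> order two
    is enough, since \<open>t\<^sup>2\<close> is then the smaller power.\<close>
  obtain v where v: "\<bar>v\<bar> \<le> 1" and "cos t = (\<Sum>m<4. cos_coeff m * t ^ m) + v / fact 4 * t ^ 4"
    using Maclaurin_cos_expansion[of t 4] abs_cos_le_one by blast
  moreover have "(\<Sum>m<4. cos_coeff m * t ^ m) = 1 - t\<^sup>2 / 2"
    by (simp add: numeral_eq_Suc cos_coeff_Suc sin_coeff_Suc)
  ultimately have "cos t - (1 - t\<^sup>2 / 2) = v / 24 * t ^ 4"
    by (simp add: fact_numeral)
  then have "\<bar>cos t - (1 - t\<^sup>2 / 2)\<bar> = \<bar>v\<bar> / 24 * \<bar>t\<bar> ^ 4"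
    by (simp only: abs_mult abs_divide power_abs abs_numeral)
  also have "\<dots> \<le> 1 * \<bar>t\<bar> ^ 4"
    using v by (intro mult_right_mono) auto
  also have "\<dots> \<le> \<bar>t\<bar> powr (2 + \<eta>)"
  proof (cases "t = 0")
    case False
    then have "\<bar>t\<bar> ^ 4 = \<bar>t\<bar> powr 4" by (simp add: powr_numeral)
    also have "\<dots> \<le> \<bar>t\<bar> powr (2 + \<eta>)" using True assms by (intro powr_mono') auto
    finally show ?thesis by simp
  qed simp
  finally show ?thesis .
next
  case False
  obtain v where v: "\<bar>v\<bar> \<le> 1" and "cos t = (\<Sum>m<2. cos_coeff m * t ^ m) + v / fact 2 * t ^ 2"
    using Maclaurin_cos_expansion[of t 2] abs_cos_le_one by blast
  moreover have "(\<Sum>m<2. cos_coeff m * t ^ m) = 1"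
    by (simp add: numeral_eq_Suc cos_coeff_Suc sin_coeff_Suc)
  ultimately have "cos t - 1 = v / 2 * t\<^sup>2"
    by simp
  then have "\<bar>cos t - 1\<bar> = \<bar>v\<bar> / 2 * t\<^sup>2"
    by (simp only: abs_mult abs_divide power2_abs abs_numeral abs_power2)
  also have "\<dots> \<le> 1 / 2 * t\<^sup>2"
    using v by (intro mult_right_mono) auto
  finally have "\<bar>cos t - (1 - t\<^sup>2 / 2)\<bar> \<le> t\<^sup>2"
    using zero_le_power2[of t] by linarith
  also have "\<dots> = \<bar>t\<bar> powr 2" using False by (simp add: powr_numeral)
  also have "\<dots> \<le> \<bar>t\<bar> powr (2 + \<eta>)" using False assms by (intro powr_mono) auto
  finally show ?thesis .
qed

lemma sin_linear_error:
  fixes t \<eta> :: real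
  assumes "0 < \<eta>" "\<eta> < 1"
  shows "\<bar>sin t - t\<bar> \<le> 2 * \<bar>t\<bar> powr (2 + \<eta>)"
proof (cases "\<bar>t\<bar> \<le> 1")
  case True
  have "\<bar>sin t - t\<bar> \<le> inverse (fact 3) * \<bar>t\<bar> ^ 3"
    using Maclaurin_sin_bound[of t 3] by (simp add: sin_coeff_def eval_nat_numeral)
  also have "\<dots> \<le> 2 * \<bar>t\<bar> ^ 3" by (intro mult_right_mono) (auto simp: fact_numeral)
  also have "\<dots> \<le> 2 * \<bar>t\<bar> powr (2 + \<eta>)"
  proof (cases "t = 0")
    case False
    then have "\<bar>t\<bar> ^ 3 = \<bar>t\<bar> powr 3" by (simp add: powr_numeral)
    also have "\<dots> \<le> \<bar>t\<bar> powr (2 + \<eta>)" using True assms by (intro powr_mono') auto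
    finally show ?thesis by simp
  qed simp
  finally show ?thesis .
next
  case False
  have "\<bar>sin t - t\<bar> \<le> 2 * \<bar>t\<bar>"
    using abs_sin_x_le_abs_x[of t] by linarith
  also have "\<dots> = 2 * \<bar>t\<bar> powr 1" using False by simp
  also have "\<dots> \<le> 2 * \<bar>t\<bar> powr (2 + \<eta>)"
    using False assms by (intro mult_left_mono powr_mono) auto
  finally show ?thesis .
qed

text \<open>The bound t - t^3/6 is at least t/2 exactly when t^2 \<le> 3. It will measure how fast
  the cosine grows away from its zero at pi/2.\<close>

lemma sin_ge_half:
  fixes t :: real
  assumes "0 \<le> t" "t\<^sup>2 \<le> 3"
  shows "t / 2 \<le> sin t"
proof -
  have "\<bar>sin t - t\<bar> \<le> inverse (fact 3) * \<bar>t\<bar> ^ 3"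
    using Maclaurin_sin_bound[of t 3] by (simp add: sin_coeff_def eval_nat_numeral)
  also have "\<dots> = t\<^sup>2 * t / 6"
    using assms by (simp add: fact_numeral power2_eq_square power3_eq_cube)
  also have "\<dots> \<le> 3 * t / 6"
    using assms by (intro divide_right_mono mult_right_mono) auto
  finally show ?thesis by linarith
qed

text \<open>Fubini for the joint law of \<open>U\<close> and \<open>V\<close>, pulled back to
  \<open>M\<close>. It does the work of conditioning on the past: \<open>U\<close> is frozen while
  the next step \<open>V\<close> is averaged.\<close>

lemma (in prob_space) indep_var_expectation_iterated:
  fixes f :: "'b \<times> 'b \<Rightarrow> real"
  assumes ind: "indep_var N U K V"
    and f[measurable]: "f \<in> borel_measurable (N \<Otimes>\<^sub>M K)" and bd: "\<And>p. \<bar>f p\<bar> \<le> B"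
  shows "(\<integral>\<omega>. f (U \<omega>, V \<omega>) \<partial>M) = (\<integral>\<omega>. (\<integral>\<omega>'. f (U \<omega>, V \<omega>') \<partial>M) \<partial>M)"
proof -
  have U[measurable]: "U \<in> measurable M N" and V[measurable]: "V \<in> measurable M K"
    using ind by (auto dest: indep_var_rv1 indep_var_rv2)
  interpret N: prob_space "distr M N U" by (rule prob_space_distr) fact
  interpret K: prob_space "distr M K V" by (rule prob_space_distr) fact
  interpret NK: pair_prob_space "distr M N U" "distr M K V" ..
  have eq: "distr M N U \<Otimes>\<^sub>M distr M K V = distr M (N \<Otimes>\<^sub>M K) (\<lambda>\<omega>. (U \<omega>, V \<omega>))"
    using ind indep_var_distribution_eq by blast
  have int: "integrable (distr M N U \<Otimes>\<^sub>M distr M K V) f"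
    by (rule NK.integrable_const_bound[where B = B]) (use bd in auto)
  have "(\<integral>\<omega>. f (U \<omega>, V \<omega>) \<partial>M) = integral\<^sup>L (distr M N U \<Otimes>\<^sub>M distr M K V) f"
    unfolding eq by (subst integral_distr) auto
  also have "\<dots> = (\<integral>u. (\<integral>v. f (u, v) \<partial>distr M K V) \<partial>distr M N U)"
    by (rule NK.integral_fst'[OF int, symmetric])
  also have "\<dots> = (\<integral>\<omega>. (\<integral>v. f (U \<omega>, v) \<partial>distr M K V) \<partial>M)"
    by (rule integral_distr) measurable
  also have "\<dots> = (\<integral>\<omega>. (\<integral>\<omega>'. f (U \<omega>, V \<omega>') \<partial>M) \<partial>M)"
  proof (rule Bochner_Integration.integral_cong[OF refl])
    fix \<omega> assume "\<omega> \<in> space M"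
    then have "U \<omega> \<in> space N" using U by (rule measurable_space[rotated])
    then show "(\<integral>v. f (U \<omega>, v) \<partial>distr M K V) = (\<integral>\<omega>'. f (U \<omega>, V \<omega>') \<partial>M)"
      by (intro integral_distr) measurable
  qed
  finally show ?thesis .
qed

subsection \<open>Trigonometric moments of a step\<close>

locale centered_walk = prob_space M for M :: "'a measure" +
  fixes X :: "'a \<Rightarrow> real" and Xs :: "nat \<Rightarrow> 'a \<Rightarrow> real" and \<sigma> \<eta> :: real
  assumes iid: "iid_copies M X Xs"
    and integrable_X: "integrable M X" and mean_zero: "(\<integral>\<omega>. X \<omega> \<partial>M) = 0"
    and integrable_X2: "integrable M (\<lambda>\<omega>. (X \<omega>)\<^sup>2)"
    and variance_X: "(\<integral>\<omega>. (X \<omega>)\<^sup>2 \<partial>M) = \<sigma>\<^sup>2"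
    and sigma_pos: "0 < \<sigma>"
    and eta_pos: "0 < \<eta>" and eta_less: "\<eta> < 1"
    and integrable_moment: "integrable M (\<lambda>\<omega>. \<bar>X \<omega>\<bar> powr (2 + \<eta>))"
begin

definition moment :: real where
  "moment = (\<integral>\<omega>. \<bar>X \<omega>\<bar> powr (2 + \<eta>) \<partial>M)"

lemma moment_nonneg: "0 \<le> moment"
  unfolding moment_def by (rule integral_nonneg_AE) simp

lemma measurable_X[measurable]: "X \<in> borel_measurable M"
  using integrable_X by simp

lemma measurable_Xs[measurable]: "k \<ge> 1 \<Longrightarrow> Xs k \<in> borel_measurable M"
  using iid unfolding iid_copies_def indep_vars_def by auto

lemma integrable_moment_scaled:
  assumes "0 < \<theta>"
  shows "integrable M (\<lambda>\<omega>. \<bar>\<theta> * X \<omega>\<bar> powr (2 + \<eta>))"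
  using integrable_moment assms by (simp add: abs_mult powr_mult)

lemma integral_moment_scaled:
  assumes "0 < \<theta>"
  shows "(\<integral>\<omega>. \<bar>\<theta> * X \<omega>\<bar> powr (2 + \<eta>) \<partial>M) = moment * \<theta> powr (2 + \<eta>)"
  using assms by (simp add: abs_mult powr_mult moment_def)

lemma integrable_bounded:
  fixes f :: "'a \<Rightarrow> real"
  assumes "f \<in> borel_measurable M" "\<And>\<omega>. \<bar>f \<omega>\<bar> \<le> B"
  shows "integrable M f"
  by (rule integrable_const_bound[where B = B]) (use assms in auto)

lemma expectation_cos:
  assumes "0 < \<theta>"
  shows "\<bar>(\<integral>\<omega>. cos (\<theta> * X \<omega>) \<partial>M) - (1 - \<theta>\<^sup>2 * \<sigma>\<^sup>2 / 2)\<bar> \<le> moment * \<theta> powr (2 + \<eta>)"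
proof -
  have i1: "integrable M (\<lambda>\<omega>. cos (\<theta> * X \<omega>))"
    by (rule integrable_bounded[where B = 1]) auto
  have X2: "(\<theta> * X \<omega>)\<^sup>2 / 2 = \<theta>\<^sup>2 / 2 * (X \<omega>)\<^sup>2" for \<omega>
    by (simp add: power_mult_distrib)
  have i3: "integrable M (\<lambda>\<omega>. \<theta>\<^sup>2 / 2 * (X \<omega>)\<^sup>2)"
    by (intro integrable_mult_right integrable_X2)
  then have i2: "integrable M (\<lambda>\<omega>. 1 - (\<theta> * X \<omega>)\<^sup>2 / 2)"
    unfolding X2 by (intro Bochner_Integration.integrable_diff integrable_const)
  have "(\<integral>\<omega>. 1 - (\<theta> * X \<omega>)\<^sup>2 / 2 \<partial>M) = (\<integral>\<omega>. 1 \<partial>M) - (\<integral>\<omega>. \<theta>\<^sup>2 / 2 * (X \<omega>)\<^sup>2 \<partial>M)"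
    unfolding X2 by (intro Bochner_Integration.integral_diff integrable_const i3)
  also have "\<dots> = 1 - \<theta>\<^sup>2 * \<sigma>\<^sup>2 / 2"
    unfolding integral_mult_right_zero variance_X by (simp add: prob_space)
  finally have "(\<integral>\<omega>. cos (\<theta> * X \<omega>) \<partial>M) - (1 - \<theta>\<^sup>2 * \<sigma>\<^sup>2 / 2)
      = (\<integral>\<omega>. cos (\<theta> * X \<omega>) - (1 - (\<theta> * X \<omega>)\<^sup>2 / 2) \<partial>M)"
    using Bochner_Integration.integral_diff[OF i1 i2] by simp
  then have "\<bar>(\<integral>\<omega>. cos (\<theta> * X \<omega>) \<partial>M) - (1 - \<theta>\<^sup>2 * \<sigma>\<^sup>2 / 2)\<bar>
      = \<bar>\<integral>\<omega>. cos (\<theta> * X \<omega>) - (1 - (\<theta> * X \<omega>)\<^sup>2 / 2) \<partial>M\<bar>"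
    by simp
  also have "\<dots> \<le> (\<integral>\<omega>. \<bar>cos (\<theta> * X \<omega>) - (1 - (\<theta> * X \<omega>)\<^sup>2 / 2)\<bar> \<partial>M)"
    by (rule integral_abs_bound)
  also have "\<dots> \<le> (\<integral>\<omega>. \<bar>\<theta> * X \<omega>\<bar> powr (2 + \<eta>) \<partial>M)"
    by (intro integral_mono integrable_abs Bochner_Integration.integrable_diff i1 i2
        integrable_moment_scaled assms cos_quadratic_error eta_pos eta_less)
  finally show ?thesis unfolding integral_moment_scaled[OF assms] .
qed

text \<open>Since \<open>X\<close> is centred, the linear term can be subtracted for free, and only
  the remainder of the sine is left.\<close>

lemma expectation_sin:
  assumes "0 < \<theta>"
  shows "\<bar>\<integral>\<omega>. sin (\<theta> * X \<omega>) \<partial>M\<bar> \<le> 2 * moment * \<theta> powr (2 + \<eta>)"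
proof -
  have i1: "integrable M (\<lambda>\<omega>. sin (\<theta> * X \<omega>))"
    by (rule integrable_bounded[where B = 1]) auto
  have i2: "integrable M (\<lambda>\<omega>. \<theta> * X \<omega>)"
    using integrable_X by simp
  have "(\<integral>\<omega>. \<theta> * X \<omega> \<partial>M) = 0" unfolding integral_mult_right_zero mean_zero by simp
  then have "\<bar>\<integral>\<omega>. sin (\<theta> * X \<omega>) \<partial>M\<bar> = \<bar>\<integral>\<omega>. sin (\<theta> * X \<omega>) - \<theta> * X \<omega> \<partial>M\<bar>"
    unfolding Bochner_Integration.integral_diff[OF i1 i2] by (simp only: diff_zero)
  also have "\<dots> \<le> (\<integral>\<omega>. \<bar>sin (\<theta> * X \<omega>) - \<theta> * X \<omega>\<bar> \<partial>M)"
    by (rule integral_abs_bound)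
  also have "\<dots> \<le> (\<integral>\<omega>. 2 * \<bar>\<theta> * X \<omega>\<bar> powr (2 + \<eta>) \<partial>M)"
    by (intro integral_mono integrable_abs Bochner_Integration.integrable_diff i1 i2
        integrable_mult_right integrable_moment_scaled assms sin_linear_error eta_pos eta_less)
  finally show ?thesis
    unfolding integral_mult_right_zero integral_moment_scaled[OF assms] by (simp add: mult.assoc)
qed

text \<open>The addition formula separates \<open>x\<close> from the step. The cosine error
  contributes 1 and the sine error 2 to the constant 3, uniformly in \<open>x\<close>.\<close>

lemma expectation_cos_shift:
  assumes "0 < \<theta>"
  shows "\<bar>(\<integral>\<omega>. cos (\<theta> * (x + X \<omega>)) \<partial>M) - (1 - \<theta>\<^sup>2 * \<sigma>\<^sup>2 / 2) * cos (\<theta> * x)\<bar>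
    \<le> 3 * moment * \<theta> powr (2 + \<eta>)"
proof -
  let ?C = "\<integral>\<omega>. cos (\<theta> * X \<omega>) \<partial>M" and ?S = "\<integral>\<omega>. sin (\<theta> * X \<omega>) \<partial>M"
  let ?D = "?C - (1 - \<theta>\<^sup>2 * \<sigma>\<^sup>2 / 2)"
  have alg: "I - l * c = c * (C - l) - s" if "I = c * C - s" for I l c C s :: real
    using that by (simp add: algebra_simps)
  have i1: "integrable M (\<lambda>\<omega>. cos (\<theta> * X \<omega>))" "integrable M (\<lambda>\<omega>. sin (\<theta> * X \<omega>))"
    by (rule integrable_bounded[where B = 1]; auto)+
  have "(\<integral>\<omega>. cos (\<theta> * (x + X \<omega>)) \<partial>M)
      = (\<integral>\<omega>. cos (\<theta> * x) * cos (\<theta> * X \<omega>) - sin (\<theta> * x) * sin (\<theta> * X \<omega>) \<partial>M)"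
    by (simp only: distrib_left cos_add)
  also have "\<dots> = cos (\<theta> * x) * ?C - sin (\<theta> * x) * ?S"
    by (subst Bochner_Integration.integral_diff)
      (simp_all only: integrable_mult_right i1 integral_mult_right_zero)
  finally have "(\<integral>\<omega>. cos (\<theta> * (x + X \<omega>)) \<partial>M) - (1 - \<theta>\<^sup>2 * \<sigma>\<^sup>2 / 2) * cos (\<theta> * x)
      = cos (\<theta> * x) * ?D - sin (\<theta> * x) * ?S"
    using alg by blast
  then have "\<bar>(\<integral>\<omega>. cos (\<theta> * (x + X \<omega>)) \<partial>M) - (1 - \<theta>\<^sup>2 * \<sigma>\<^sup>2 / 2) * cos (\<theta> * x)\<bar>
      = \<bar>cos (\<theta> * x) * ?D - sin (\<theta> * x) * ?S\<bar>"
    by (rule arg_cong)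
  also have "\<dots> \<le> \<bar>cos (\<theta> * x)\<bar> * \<bar>?D\<bar> + \<bar>sin (\<theta> * x)\<bar> * \<bar>?S\<bar>"
    by (rule order_trans[OF abs_triangle_ineq4]) (simp only: abs_mult order_refl)
  also have "\<dots> \<le> 1 * \<bar>?D\<bar> + 1 * \<bar>?S\<bar>"
    by (intro add_mono mult_right_mono) auto
  also have "\<dots> \<le> moment * \<theta> powr (2 + \<eta>) + 2 * moment * \<theta> powr (2 + \<eta>)"
    unfolding mult_1 by (intro add_mono expectation_cos expectation_sin assms)
  also have "\<dots> = 3 * moment * \<theta> powr (2 + \<eta>)"
    by (simp add: algebra_simps)
  finally show ?thesis .
qed

text \<open>One family serves all three estimates: \<epsilon> = 0 for the exponential decay,
  \<epsilon> = -1/4 for the time spent in the strip, and a small \<epsilon> \<ge> 0 for the lower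
  bound.\<close>

definition bump :: "real \<Rightarrow> real \<Rightarrow> real \<Rightarrow> real" where
  "bump \<epsilon> \<theta> x = cos (\<theta> * x) + \<epsilon> * (cos (\<theta> * x))\<^sup>2"

lemma measurable_bump[measurable]: "bump \<epsilon> \<theta> \<in> borel_measurable borel"
  unfolding bump_def by measurable

lemma abs_bump_le: "\<bar>\<epsilon>\<bar> \<le> 1 \<Longrightarrow> \<bar>bump \<epsilon> \<theta> x\<bar> \<le> 2"
proof -
  assume e: "\<bar>\<epsilon>\<bar> \<le> 1"
  have "(cos (\<theta> * x))\<^sup>2 \<le> 1" by (simp add: abs_square_le_1)
  then have "\<bar>\<epsilon> * (cos (\<theta> * x))\<^sup>2\<bar> \<le> 1 * 1"
    unfolding abs_mult using e by (intro mult_mono) auto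
  then show ?thesis unfolding bump_def using abs_cos_le_one[of "\<theta> * x"] by linarith
qed

text \<open>The double angle formula turns the square into a cosine of frequency 2\<theta>, whose
  factor is 1 - 4L; this yields the drift \<epsilon>L(2 - 4c^2). Doubling the frequency multiplies
  the error by at most 8, so the constant is 3 + (1/2) * 24 = 15.\<close>

lemma expectation_bump_shift:
  assumes "0 < \<theta>" "\<bar>\<epsilon>\<bar> \<le> 1"
  defines "L \<equiv> \<theta>\<^sup>2 * \<sigma>\<^sup>2 / 2" and "c \<equiv> \<lambda>x. cos (\<theta> * x)"
  shows "\<bar>(\<integral>\<omega>. bump \<epsilon> \<theta> (x + X \<omega>) \<partial>M) - (bump \<epsilon> \<theta> x - L * c x + \<epsilon> * L * (2 - 4 * (c x)\<^sup>2))\<bar>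
    \<le> 15 * moment * \<theta> powr (2 + \<eta>)"
proof -
  let ?I1 = "\<integral>\<omega>. cos (\<theta> * (x + X \<omega>)) \<partial>M" and ?I2 = "\<integral>\<omega>. cos (2 * \<theta> * (x + X \<omega>)) \<partial>M"
  let ?P = "moment * \<theta> powr (2 + \<eta>)"
  have sq: "(cos (\<theta> * z))\<^sup>2 = (1 + cos (2 * \<theta> * z)) / 2" for z
    using cos_double_cos[of "\<theta> * z"] by (simp add: mult.assoc)
  have b: "bump \<epsilon> \<theta> z = cos (\<theta> * z) + \<epsilon> / 2 + \<epsilon> / 2 * cos (2 * \<theta> * z)" for z
    unfolding bump_def sq by (simp add: field_simps)
  have i1: "integrable M (\<lambda>\<omega>. cos (\<theta> * (x + X \<omega>)))" "integrable M (\<lambda>\<omega>. cos (2 * \<theta> * (x + X \<omega>)))"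
    by (rule integrable_bounded[where B = 1]; auto)+
  have I: "(\<integral>\<omega>. bump \<epsilon> \<theta> (x + X \<omega>) \<partial>M) = ?I1 + \<epsilon> / 2 + \<epsilon> / 2 * ?I2"
    unfolding b using i1 by (subst Bochner_Integration.integral_add)
      (simp_all only: Bochner_Integration.integral_add Bochner_Integration.integrable_add integrable_mult_right integrable_const
        integral_mult_right_zero lebesgue_integral_const prob_space scaleR_one)
  have d2: "4 * (c x)\<^sup>2 = 2 + 2 * cos (2 * \<theta> * x)"
    unfolding c_def sq by simp
  have 1: "\<bar>?I1 - (1 - L) * c x\<bar> \<le> 3 * ?P"
    using expectation_cos_shift[OF assms(1), of x] unfolding L_def c_def by (simp only: mult.assoc)
  have "\<bar>?I2 - (1 - 4 * L) * cos (2 * \<theta> * x)\<bar> \<le> 3 * (moment * (2 * \<theta>) powr (2 + \<eta>))"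
  proof -
    have "(2 * \<theta>)\<^sup>2 * \<sigma>\<^sup>2 / 2 = 4 * L" "0 < 2 * \<theta>"
      using assms(1) by (simp_all add: L_def power_mult_distrib)
    then show ?thesis
      using expectation_cos_shift[of "2 * \<theta>" x] by (simp only: mult.assoc)
  qed
  also have "\<dots> \<le> 24 * ?P"
  proof -
    have "2 powr (2 + \<eta>) \<le> (2::real) powr 3"
      using eta_less by (intro powr_mono) auto
    then have "2 powr (2 + \<eta>) \<le> (8::real)" by (simp add: powr_numeral)
    then have "2 powr (2 + \<eta>) * ?P \<le> 8 * ?P"
      using moment_nonneg by (intro mult_right_mono) auto
    then show ?thesis using assms(1) by (simp add: powr_mult mult_ac)
  qed
  finally have 2: "\<bar>?I2 - (1 - 4 * L) * cos (2 * \<theta> * x)\<bar> \<le> 24 * ?P" .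
  have 3: "\<bar>\<epsilon> / 2 * (?I2 - (1 - 4 * L) * cos (2 * \<theta> * x))\<bar> \<le> 1 / 2 * (24 * ?P)"
    unfolding abs_mult using assms(2) 2 by (intro mult_mono) auto
  have eq: "(\<integral>\<omega>. bump \<epsilon> \<theta> (x + X \<omega>) \<partial>M) - (bump \<epsilon> \<theta> x - L * c x + \<epsilon> * L * (2 - 4 * (c x)\<^sup>2))
      = (?I1 - (1 - L) * c x) + \<epsilon> / 2 * (?I2 - (1 - 4 * L) * cos (2 * \<theta> * x))"
  proof -
    have "I + \<epsilon> / 2 + \<epsilon> / 2 * J - (k + \<epsilon> / 2 + \<epsilon> / 2 * d - L * k + \<epsilon> * L * (2 - (2 + 2 * d)))
        = (I - (1 - L) * k) + \<epsilon> / 2 * (J - (1 - 4 * L) * d)" for I J k d :: real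
      by (simp add: field_simps)
    then show ?thesis unfolding I d2 unfolding b c_def by blast
  qed
  have "\<bar>(\<integral>\<omega>. bump \<epsilon> \<theta> (x + X \<omega>) \<partial>M) - (bump \<epsilon> \<theta> x - L * c x + \<epsilon> * L * (2 - 4 * (c x)\<^sup>2))\<bar>
      \<le> 3 * ?P + 1 / 2 * (24 * ?P)"
    unfolding eq by (rule order_trans[OF abs_triangle_ineq add_mono[OF 1 3]])
  then show ?thesis by (simp add: mult.assoc)
qed

subsection \<open>The killed walk\<close>

text \<open>A quantifier instead of a maximum makes \<open>stays b 0\<close> the whole space, which
  is where the inductions start.\<close>

definition stays :: "real \<Rightarrow> nat \<Rightarrow> 'a set" where
  "stays b n = {\<omega> \<in> space M. \<forall>k\<in>{1..n}. \<bar>partial_sum Xs k \<omega>\<bar> \<le> b}"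

lemma measurable_partial_sum[measurable]: "partial_sum Xs n \<in> borel_measurable M"
  unfolding partial_sum_def by measurable

lemma sets_stays[measurable]: "stays b n \<in> sets M"
  unfolding stays_def by measurable

lemma stays_0: "stays b 0 = space M"
  by (auto simp: stays_def)

lemma stays_antimono: "m \<le> n \<Longrightarrow> stays b n \<subseteq> stays b m"
  by (auto simp: stays_def)

lemma indicator_stays_Suc:
  assumes "\<omega> \<in> space M"
  shows "indicator (stays b (Suc n)) \<omega>
    = (indicator (stays b n) \<omega> * indicator {-b..b} (partial_sum Xs n \<omega> + Xs (Suc n) \<omega>) :: real)"
  using assms by (auto simp: stays_def indicator_def atLeastAtMostSuc_conv partial_sum_def abs_le_iff)

text \<open>The Markov property of the killed walk: the last step is independent of the first
  \<open>n\<close> and distributed as \<open>X\<close>, so it can be averaged first with the past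
  held fixed.\<close>

lemma expectation_stays_Suc:
  fixes f :: "real \<Rightarrow> real"
  assumes f[measurable]: "f \<in> borel_measurable borel" and bd: "\<And>x. \<bar>f x\<bar> \<le> B"
  shows "(\<integral>\<omega>. f (partial_sum Xs (Suc n) \<omega>) * indicator (stays b (Suc n)) \<omega> \<partial>M)
    = (\<integral>\<omega>. (\<integral>\<omega>'. f (partial_sum Xs n \<omega> + X \<omega>') * indicator {-b..b} (partial_sum Xs n \<omega> + X \<omega>') \<partial>M)
          * indicator (stays b n) \<omega> \<partial>M)"
proof -
  let ?N = "PiM {1..n} (\<lambda>_. borel :: real measure)" and ?K = "PiM {Suc n} (\<lambda>_. borel :: real measure)"
  let ?U = "\<lambda>\<omega>. restrict (\<lambda>i. Xs i \<omega>) {1..n}" and ?V = "\<lambda>\<omega>. restrict (\<lambda>i. Xs i \<omega>) {Suc n}"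
  define S where "S v k = (\<Sum>i=1..k. v i)" for v :: "nat \<Rightarrow> real" and k :: nat
  \<comment> \<open>The integrand as a function of two blocks of coordinates, \<open>{1..n}\<close>
    and \<open>{Suc n}\<close>, which are disjoint and therefore independent.\<close>
  define g where "g = (\<lambda>(v, w). f (S v n + w (Suc n)) * indicator {-b..b} (S v n + w (Suc n))
      * (if \<forall>k\<in>{1..n}. \<bar>S v k\<bar> \<le> b then 1 else 0))"
  have SN: "(\<lambda>v. S v k) \<in> borel_measurable ?N" if "k \<le> n" for k
    unfolding S_def using that by (intro borel_measurable_sum measurable_component_singleton) auto
  have [measurable]: "(\<lambda>v. S v n) \<in> borel_measurable ?N" by (rule SN) simp
  have [measurable]: "Measurable.pred ?N (\<lambda>v. \<forall>k\<in>{1..n}. \<bar>S v k\<bar> \<le> b)"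
    using SN by (intro pred_intros_finite) (auto intro!: borel_measurable_le borel_measurable_abs)
  have [measurable]: "(\<lambda>w. w (Suc n)) \<in> borel_measurable ?K"
    by (intro measurable_component_singleton) auto
  have gm[measurable]: "g \<in> borel_measurable (?N \<Otimes>\<^sub>M ?K)"
    unfolding g_def by measurable
  have "0 \<le> B" using bd[of 0] by linarith
  then have gb: "\<bar>g p\<bar> \<le> B" for p
    using bd by (auto simp: g_def indicator_def split: prod.splits)
  have "indep_vars (\<lambda>_. borel) Xs {1..}" using iid by (simp add: iid_copies_def)
  then have ind: "indep_var ?N ?U ?K ?V" by (rule indep_var_restrict) auto
  have d: "distr M borel (Xs (Suc n)) = distr M borel X"
    using iid by (simp add: iid_copies_def)
  have SU: "S (?U \<omega>) k = partial_sum Xs k \<omega>" if "k \<le> n" for k \<omega>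
    unfolding S_def partial_sum_def using that by (intro sum.cong) auto
  define h where "h \<omega> y = f (partial_sum Xs n \<omega> + y) * indicator {-b..b} (partial_sum Xs n \<omega> + y)" for \<omega> y
  have gU: "g (?U \<omega>, ?V \<omega>') = h \<omega> (Xs (Suc n) \<omega>') * indicator (stays b n) \<omega>"
    if "\<omega> \<in> space M" for \<omega> \<omega>'
  proof -
    have "(\<forall>k\<in>{1..n}. \<bar>S (?U \<omega>) k\<bar> \<le> b) \<longleftrightarrow> \<omega> \<in> stays b n"
      using that by (auto simp: SU stays_def simp del: One_nat_def)
    moreover have "S (?U \<omega>) n = partial_sum Xs n \<omega>" by (rule SU) simp
    ultimately show ?thesis
      unfolding g_def h_def by (simp add: indicator_def)
  qed
  have "(\<integral>\<omega>. f (partial_sum Xs (Suc n) \<omega>) * indicator (stays b (Suc n)) \<omega> \<partial>M)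
      = (\<integral>\<omega>. g (?U \<omega>, ?V \<omega>) \<partial>M)"
  proof (rule Bochner_Integration.integral_cong[OF refl])
    fix \<omega> assume w: "\<omega> \<in> space M"
    have "partial_sum Xs (Suc n) \<omega> = partial_sum Xs n \<omega> + Xs (Suc n) \<omega>"
      by (simp add: partial_sum_def)
    then show "f (partial_sum Xs (Suc n) \<omega>) * indicator (stays b (Suc n)) \<omega> = g (?U \<omega>, ?V \<omega>)"
      unfolding gU[OF w] indicator_stays_Suc[OF w] h_def by simp
  qed
  also have "\<dots> = (\<integral>\<omega>. (\<integral>\<omega>'. g (?U \<omega>, ?V \<omega>') \<partial>M) \<partial>M)"
    by (rule indep_var_expectation_iterated[OF ind gm gb])
  also have "\<dots> = (\<integral>\<omega>. (\<integral>\<omega>'. h \<omega> (Xs (Suc n) \<omega>') \<partial>M) * indicator (stays b n) \<omega> \<partial>M)"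
    by (intro Bochner_Integration.integral_cong refl) (simp add: gU del: One_nat_def)
  also have "\<dots> = (\<integral>\<omega>. (\<integral>\<omega>'. h \<omega> (X \<omega>') \<partial>M) * indicator (stays b n) \<omega> \<partial>M)"
  \<comment> \<open>Only the law of the last step enters the inner integral, so the generic copy
    \<open>X\<close> can replace it.\<close>
  proof -
    have m: "h \<omega> \<in> borel_measurable borel" for \<omega>
      unfolding h_def by measurable
    have "(\<integral>\<omega>'. h \<omega> (Xs (Suc n) \<omega>') \<partial>M) = (\<integral>y. h \<omega> y \<partial>distr M borel (Xs (Suc n)))" for \<omega>
      by (rule integral_distr[symmetric]) (use m in auto)
    also have "\<dots> \<omega> = (\<integral>\<omega>'. h \<omega> (X \<omega>') \<partial>M)" for \<omega>
      unfolding d by (rule integral_distr) (use m in auto)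
    finally show ?thesis by simp
  qed
  also have "\<dots> = (\<integral>\<omega>. (\<integral>\<omega>'. f (partial_sum Xs n \<omega> + X \<omega>') * indicator {-b..b} (partial_sum Xs n \<omega> + X \<omega>') \<partial>M)
          * indicator (stays b n) \<omega> \<partial>M)"
    unfolding h_def ..
  finally show ?thesis .
qed

text \<open>For \<open>\<bar>\<epsilon>\<bar> \<le> 1\<close> the second factor is nonnegative, so
  \<open>bump\<close> is nonnegative where the cosine is and nonpositive where the cosine
  is.\<close>

lemma bump_factor: "bump \<epsilon> \<theta> x = cos (\<theta> * x) * (1 + \<epsilon> * cos (\<theta> * x))"
  by (simp add: bump_def power2_eq_square algebra_simps)

lemma integrable_bump_shift: "\<bar>\<epsilon>\<bar> \<le> 1 \<Longrightarrow> integrable M (\<lambda>\<omega>. bump \<epsilon> \<theta> (x + X \<omega>))"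
  by (rule integrable_bounded[where B = 2]) (auto intro: abs_bump_le)

lemma integrable_bump_killed:
  "\<bar>\<epsilon>\<bar> \<le> 1 \<Longrightarrow> integrable M (\<lambda>\<omega>. bump \<epsilon> \<theta> (x + X \<omega>) * indicator {-b..b} (x + X \<omega>))"
  by (rule integrable_bounded[where B = 2]) (auto simp: indicator_def intro: abs_bump_le)

lemma one_plus_small_cos_nonneg: "\<bar>\<epsilon>\<bar> \<le> 1 \<Longrightarrow> 0 \<le> 1 + \<epsilon> * cos y" for \<epsilon> y :: real
  using mult_mono[of "\<bar>\<epsilon>\<bar>" 1 "\<bar>cos y\<bar>" 1] abs_mult[of \<epsilon> "cos y"] by auto

text \<open>Below, the powers of \<open>\<bar>q y\<bar>\<close> and \<open>\<bar>\<theta> y\<bar>\<close> in the pointwise bounds absorb the jumps that leave the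
  region in which the sign of \<open>bump\<close> is controlled.\<close>

lemma killed_bump_upper:
  assumes b: "0 < b" and s: "0 < s" "s \<le> 1" and th: "\<theta> = pi / (2 * (b * (1 + s)))"
    and e: "\<bar>\<epsilon>\<bar> \<le> 1" and x: "\<bar>x\<bar> \<le> b"
  defines "L \<equiv> \<theta>\<^sup>2 * \<sigma>\<^sup>2 / 2"
  shows "(\<integral>\<omega>. bump \<epsilon> \<theta> (x + X \<omega>) * indicator {-b..b} (x + X \<omega>) \<partial>M)
    \<le> bump \<epsilon> \<theta> x - L * cos (\<theta> * x) + \<epsilon> * L * (2 - 4 * (cos (\<theta> * x))\<^sup>2)
        + 17 * moment * (1 / (b * s)) powr (2 + \<eta>)"
proof -
  define q where "q = 1 / (b * s)"
  have th0: "0 < \<theta>" using b s by (simp add: th)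
  have q0: "0 < q" using b s by (simp add: q_def)
  have thb: "\<theta> * (b * (1 + s)) = pi / 2" using b s by (simp add: th)
  \<comment> \<open>This gives \<theta> \<le> q, so that the error of the free walk can also be
    written with \<open>q\<close>; the constants then add up to 15 + 2 = 17.\<close>
  have "\<theta> * (b * s) \<le> 1"
  proof -
    have "\<theta> * (b * s) = pi / 2 * (s / (1 + s))"
      unfolding thb[symmetric] using s by simp
    also have "s / (1 + s) \<le> 1 / 2" using s by (simp add: field_simps)
    then have "pi / 2 * (s / (1 + s)) \<le> pi / 2 * (1 / 2)" by (intro mult_left_mono) auto
    also have "\<dots> \<le> 1" using pi_less_4 by simp
    finally show ?thesis .
  qed
  then have thq: "\<theta> \<le> q" using b s by (simp add: q_def field_simps)
  have pw: "bump \<epsilon> \<theta> (x + y) * indicator {-b..b} (x + y) \<le> bump \<epsilon> \<theta> (x + y) + 2 * \<bar>q * y\<bar> powr (2 + \<eta>)" for y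
  proof -
    \<comment> \<open>Inside the strip nothing is killed. In the margin of width
      \<open>b * s\<close> the bump is nonnegative, so killing only lowers it. Beyond the margin the
      jump is so long that \<open>\<bar>q * y\<bar> \<ge> 1\<close>, and twice the power dominates
      the bump.\<close>
    consider "\<bar>x + y\<bar> \<le> b" | "b < \<bar>x + y\<bar>" "\<bar>x + y\<bar> \<le> b * (1 + s)" | "b * (1 + s) < \<bar>x + y\<bar>" by linarith
    then show ?thesis
    proof cases
      case 1
      then have "indicator {-b..b} (x + y) = (1::real)" by (auto simp: indicator_def abs_le_iff)
      then show ?thesis by simp
    next
      case 2
      then have i: "indicator {-b..b} (x + y) = (0::real)" by (auto simp: indicator_def)
      have "\<bar>\<theta> * (x + y)\<bar> \<le> pi / 2"
        using mult_left_mono[OF 2(2), of \<theta>] th0 thb by (simp add: abs_mult)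
      then have "0 \<le> cos (\<theta> * (x + y))" by (intro cos_ge_zero) auto
      then have "0 \<le> bump \<epsilon> \<theta> (x + y)"
        unfolding bump_factor using one_plus_small_cos_nonneg[OF e] by (intro mult_nonneg_nonneg) auto
      then show ?thesis by (simp add: i)
    next
      case 3
      have "b < b * (1 + s)" using b s by (simp add: algebra_simps)
      then have i: "indicator {-b..b} (x + y) = (0::real)" using 3 by (auto simp: indicator_def)
      have "b * s \<le> \<bar>y\<bar>" using 3 x by (simp add: algebra_simps)
      then have "1 \<le> \<bar>q * y\<bar>" using b s by (simp add: q_def abs_mult field_simps)
      then have "1 \<le> \<bar>q * y\<bar> powr (2 + \<eta>)" using eta_pos by (intro ge_one_powr_ge_zero) auto
      then show ?thesis using abs_bump_le[OF e, of \<theta> "x + y"] by (simp add: i)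
    qed
  qed
  have iq: "integrable M (\<lambda>\<omega>. 2 * \<bar>q * X \<omega>\<bar> powr (2 + \<eta>))"
    by (intro integrable_mult_right integrable_moment_scaled q0)
  have "(\<integral>\<omega>. bump \<epsilon> \<theta> (x + X \<omega>) * indicator {-b..b} (x + X \<omega>) \<partial>M)
      \<le> (\<integral>\<omega>. bump \<epsilon> \<theta> (x + X \<omega>) + 2 * \<bar>q * X \<omega>\<bar> powr (2 + \<eta>) \<partial>M)"
    by (intro integral_mono integrable_bump_killed Bochner_Integration.integrable_add iq
        integrable_bump_shift e pw)
  also have "\<dots> = (\<integral>\<omega>. bump \<epsilon> \<theta> (x + X \<omega>) \<partial>M) + 2 * (moment * q powr (2 + \<eta>))"
    unfolding Bochner_Integration.integral_add[OF integrable_bump_shift[OF e] iq]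
      integral_mult_right_zero integral_moment_scaled[OF q0] ..
  also have "\<dots> \<le> (bump \<epsilon> \<theta> x - L * cos (\<theta> * x) + \<epsilon> * L * (2 - 4 * (cos (\<theta> * x))\<^sup>2)
      + 15 * moment * \<theta> powr (2 + \<eta>)) + 2 * (moment * q powr (2 + \<eta>))"
    using expectation_bump_shift[OF th0 e, of x] unfolding L_def by (intro add_right_mono) linarith
  also have "\<dots> \<le> (bump \<epsilon> \<theta> x - L * cos (\<theta> * x) + \<epsilon> * L * (2 - 4 * (cos (\<theta> * x))\<^sup>2)
      + 15 * moment * q powr (2 + \<eta>)) + 2 * (moment * q powr (2 + \<eta>))"
    using moment_nonneg th0 thq eta_pos
    by (intro add_right_mono add_left_mono mult_left_mono powr_mono2) auto
  finally show ?thesis unfolding q_def by (simp add: algebra_simps)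
qed

text \<open>Here the cosine vanishes exactly at the edge of the strip and is nonpositive between
  \<open>b\<close> and \<open>3 * b\<close>, so killing there only helps. A landing point beyond
  \<open>3 * b\<close> needs a jump with \<open>\<bar>\<theta> * y\<bar> \<ge> 1\<close>, which the
  moment pays for.\<close>

lemma killed_bump_lower:
  assumes b: "0 < b" and th: "\<theta> = pi / (2 * b)"
    and e: "\<bar>\<epsilon>\<bar> \<le> 1" and x: "\<bar>x\<bar> \<le> b"
  defines "L \<equiv> \<theta>\<^sup>2 * \<sigma>\<^sup>2 / 2"
  shows "bump \<epsilon> \<theta> x - L * cos (\<theta> * x) + \<epsilon> * L * (2 - 4 * (cos (\<theta> * x))\<^sup>2)
        - 17 * moment * \<theta> powr (2 + \<eta>)
      \<le> (\<integral>\<omega>. bump \<epsilon> \<theta> (x + X \<omega>) * indicator {-b..b} (x + X \<omega>) \<partial>M)"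
proof -
  have th0: "0 < \<theta>" using b by (simp add: th)
  have thb: "\<theta> * b = pi / 2" using b by (simp add: th)
  have pw: "bump \<epsilon> \<theta> (x + y) - 2 * \<bar>\<theta> * y\<bar> powr (2 + \<eta>) \<le> bump \<epsilon> \<theta> (x + y) * indicator {-b..b} (x + y)" for y
  proof -
    consider "\<bar>x + y\<bar> \<le> b" | "b < \<bar>x + y\<bar>" "\<bar>x + y\<bar> \<le> 3 * b" | "3 * b < \<bar>x + y\<bar>" by linarith
    then show ?thesis
    proof cases
      case 1
      then have "indicator {-b..b} (x + y) = (1::real)" by (auto simp: indicator_def abs_le_iff)
      then show ?thesis by simp
    next
      case 2
      then have i: "indicator {-b..b} (x + y) = (0::real)" by (auto simp: indicator_def)
      have a: "\<bar>\<theta> * (x + y)\<bar> = \<theta> * \<bar>x + y\<bar>" using th0 by (simp add: abs_mult)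
      have "pi / 2 \<le> \<bar>\<theta> * (x + y)\<bar>" "\<bar>\<theta> * (x + y)\<bar> \<le> 3 * (pi / 2)"
        unfolding a thb[symmetric]
        using mult_left_mono[OF 2(2), of \<theta>] mult_left_mono[OF less_imp_le[OF 2(1)], of \<theta>] th0
        by (simp_all add: mult_ac)
      then have "0 \<le> cos (\<bar>\<theta> * (x + y)\<bar> - pi)" by (intro cos_ge_zero) linarith+
      then have "cos (\<theta> * (x + y)) \<le> 0"
        by (simp add: cos_diff)
      then have "bump \<epsilon> \<theta> (x + y) \<le> 0"
        unfolding bump_factor using one_plus_small_cos_nonneg[OF e] by (intro mult_nonpos_nonneg) auto
      moreover have "0 \<le> \<bar>\<theta> * y\<bar> powr (2 + \<eta>)" by simp
      ultimately show ?thesis unfolding i by linarith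
    next
      case 3
      then have i: "indicator {-b..b} (x + y) = (0::real)" using b by (auto simp: indicator_def)
      have "b \<le> \<bar>y\<bar>" using 3 x by linarith
      then have "\<theta> * b \<le> \<bar>\<theta> * y\<bar>" using th0 by (simp add: abs_mult)
      then have "1 \<le> \<bar>\<theta> * y\<bar>" unfolding thb using pi_ge_two by linarith
      then have "1 \<le> \<bar>\<theta> * y\<bar> powr (2 + \<eta>)" using eta_pos by (intro ge_one_powr_ge_zero) auto
      then show ?thesis using abs_bump_le[OF e, of \<theta> "x + y"] by (simp add: i)
    qed
  qed
  have iq: "integrable M (\<lambda>\<omega>. 2 * \<bar>\<theta> * X \<omega>\<bar> powr (2 + \<eta>))"
    by (intro integrable_mult_right integrable_moment_scaled th0)
  have "bump \<epsilon> \<theta> x - L * cos (\<theta> * x) + \<epsilon> * L * (2 - 4 * (cos (\<theta> * x))\<^sup>2) - 17 * moment * \<theta> powr (2 + \<eta>)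
      = (bump \<epsilon> \<theta> x - L * cos (\<theta> * x) + \<epsilon> * L * (2 - 4 * (cos (\<theta> * x))\<^sup>2)
        - 15 * moment * \<theta> powr (2 + \<eta>)) - 2 * (moment * \<theta> powr (2 + \<eta>))"
    by (simp add: algebra_simps)
  also have "\<dots> \<le> (\<integral>\<omega>. bump \<epsilon> \<theta> (x + X \<omega>) \<partial>M) - 2 * (moment * \<theta> powr (2 + \<eta>))"
    using expectation_bump_shift[OF th0 e, of x] unfolding L_def by (intro diff_right_mono) linarith
  also have "\<dots> = (\<integral>\<omega>. bump \<epsilon> \<theta> (x + X \<omega>) - 2 * \<bar>\<theta> * X \<omega>\<bar> powr (2 + \<eta>) \<partial>M)"
    unfolding Bochner_Integration.integral_diff[OF integrable_bump_shift[OF e] iq]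
      integral_mult_right_zero integral_moment_scaled[OF th0] ..
  also have "\<dots> \<le> (\<integral>\<omega>. bump \<epsilon> \<theta> (x + X \<omega>) * indicator {-b..b} (x + X \<omega>) \<partial>M)"
    by (intro integral_mono integrable_bump_killed Bochner_Integration.integrable_diff iq
        integrable_bump_shift e pw)
  finally show ?thesis .
qed

section \<open>The semigroup of the killed walk, started at the origin\<close>

definition killed_expectation :: "real \<Rightarrow> (real \<Rightarrow> real) \<Rightarrow> nat \<Rightarrow> real" where
  "killed_expectation b f n = (\<integral>\<omega>. f (partial_sum Xs n \<omega>) * indicator (stays b n) \<omega> \<partial>M)"

lemma abs_partial_sum_le_stays:
  assumes "0 \<le> b" "\<omega> \<in> stays b n"
  shows "\<bar>partial_sum Xs n \<omega>\<bar> \<le> b"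
proof (cases n)
  case 0
  then show ?thesis using assms(1) by (simp add: partial_sum_def)
next
  case (Suc k)
  then show ?thesis using assms(2) by (auto simp: stays_def simp del: One_nat_def)
qed

lemma integrable_killed:
  fixes f :: "real \<Rightarrow> real"
  assumes [measurable]: "f \<in> borel_measurable borel" and "\<And>x. \<bar>f x\<bar> \<le> B"
  shows "integrable M (\<lambda>\<omega>. f (partial_sum Xs n \<omega>) * indicator (stays b n) \<omega>)"
proof -
  have "0 \<le> B" using assms(2)[of 0] by linarith
  then show ?thesis
    by (intro integrable_bounded[where B = B]) (use assms(2) in \<open>auto simp: indicator_def\<close>)
qed

lemma killed_expectation_mono:
  assumes [measurable]: "f \<in> borel_measurable borel" "g \<in> borel_measurable borel"
    and "\<And>x. \<bar>f x\<bar> \<le> B" "\<And>x. \<bar>g x\<bar> \<le> C" and b: "0 \<le> b"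
    and fg: "\<And>x. \<bar>x\<bar> \<le> b \<Longrightarrow> f x \<le> g x"
  shows "killed_expectation b f n \<le> killed_expectation b g n"
  unfolding killed_expectation_def
  using assms abs_partial_sum_le_stays[OF b]
  by (intro integral_mono integrable_killed[where B = B] integrable_killed[where B = C])
    (auto simp: indicator_def)

text \<open>After the last step is averaged, the walk at time \<open>n\<close> is still confined to
  the strip, so an inequality for one step on the strip is enough.\<close>

lemma killed_expectation_Suc_le:
  assumes f[measurable]: "f \<in> borel_measurable borel" and g[measurable]: "g \<in> borel_measurable borel"
    and bf: "\<And>x. \<bar>f x\<bar> \<le> B" and bg: "\<And>x. \<bar>g x\<bar> \<le> C" and b: "0 \<le> b"
    and fg: "\<And>x. \<bar>x\<bar> \<le> b \<Longrightarrow> (\<integral>\<omega>. f (x + X \<omega>) * indicator {-b..b} (x + X \<omega>) \<partial>M) \<le> g x"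
  shows "killed_expectation b f (Suc n) \<le> killed_expectation b g n"
proof -
  define h where "h x = (\<integral>\<omega>. f (x + X \<omega>) * indicator {-b..b} (x + X \<omega>) \<partial>M)" for x
  have hm: "h \<in> borel_measurable borel" unfolding h_def by measurable
  have B0: "0 \<le> B" using bf[of 0] by linarith
  have hb: "\<bar>h x\<bar> \<le> B" for x
  proof -
    have bd: "\<bar>f (x + X \<omega>) * indicator {-b..b} (x + X \<omega>)\<bar> \<le> B" for \<omega>
      using bf B0 by (auto simp: indicator_def)
    have "\<bar>h x\<bar> \<le> (\<integral>\<omega>. \<bar>f (x + X \<omega>) * indicator {-b..b} (x + X \<omega>)\<bar> \<partial>M)"
      unfolding h_def by (rule integral_abs_bound)
    also have "\<dots> \<le> (\<integral>\<omega>. B \<partial>M)"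
      by (intro integral_mono integrable_bounded[where B = B]) (use bd B0 in auto)
    finally show ?thesis by (simp add: prob_space)
  qed
  have "killed_expectation b f (Suc n) = killed_expectation b h n"
    unfolding killed_expectation_def h_def by (rule expectation_stays_Suc[OF f bf])
  also have "\<dots> \<le> killed_expectation b g n"
    by (rule killed_expectation_mono[OF hm g hb bg b]) (simp add: h_def fg)
  finally show ?thesis .
qed

lemma killed_expectation_Suc_ge:
  assumes f[measurable]: "f \<in> borel_measurable borel" and g[measurable]: "g \<in> borel_measurable borel"
    and bf: "\<And>x. \<bar>f x\<bar> \<le> B" and bg: "\<And>x. \<bar>g x\<bar> \<le> C" and b: "0 \<le> b"
    and fg: "\<And>x. \<bar>x\<bar> \<le> b \<Longrightarrow> g x \<le> (\<integral>\<omega>. f (x + X \<omega>) * indicator {-b..b} (x + X \<omega>) \<partial>M)"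
  shows "killed_expectation b g n \<le> killed_expectation b f (Suc n)"
proof -
  have "killed_expectation b (\<lambda>x. - f x) (Suc n) \<le> killed_expectation b (\<lambda>x. - g x) n"
    by (rule killed_expectation_Suc_le[where B = B and C = C]) (use bf bg b fg in auto)
  then show ?thesis by (simp add: killed_expectation_def)
qed

lemma killed_expectation_const: "killed_expectation b (\<lambda>_. c) n = c * prob (stays b n)"
  unfolding killed_expectation_def by simp

lemma killed_expectation_0: "killed_expectation b f 0 = f 0"
  unfolding killed_expectation_def partial_sum_def
  by (simp add: stays_0 prob_space)

lemma killed_expectation_cmult: "killed_expectation b (\<lambda>x. c * f x) n = c * killed_expectation b f n"
  unfolding killed_expectation_def by (simp add: mult.assoc)

section \<open>Bounds for the probability of staying in a strip\<close>

lemma abs_arg_le_half_pi: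
  fixes \<theta> x b :: real
  assumes "0 \<le> \<theta>" "\<theta> * b \<le> pi / 2" "\<bar>x\<bar> \<le> b"
  shows "\<bar>\<theta> * x\<bar> \<le> pi / 2"
  using mult_left_mono[OF assms(3,1)] assms by (simp add: abs_mult)

text \<open>Widening the strip by the factor 1 + s keeps the argument at distance at least s/2 from
  pi/2, and the sine of that distance is at least half of it.\<close>

lemma cos_lower_on_strip:
  fixes b s x :: real
  assumes b: "0 < b" and s: "0 < s" "s \<le> 1" and th: "\<theta> = pi / (2 * (b * (1 + s)))"
    and x: "\<bar>x\<bar> \<le> b"
  shows "s / 4 \<le> cos (\<theta> * x)"
proof -
  define t where "t = pi / 2 - \<bar>\<theta> * x\<bar>"
  have th0: "0 < \<theta>" using b s by (simp add: th)
  have thb: "\<theta> * (b * (1 + s)) = pi / 2" using b s by (simp add: th)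
  have "\<bar>\<theta> * x\<bar> \<le> \<theta> * b" using x th0 by (simp add: abs_mult)
  also have "\<theta> * b = pi / 2 - pi / 2 * (s / (1 + s))"
    unfolding thb[symmetric] using s by (simp add: field_simps)
  finally have "pi / 2 * (s / (1 + s)) \<le> t" by (simp add: t_def)
  moreover have "1 * (s / 2) \<le> pi / 2 * (s / (1 + s))"
    using s pi_ge_two by (intro mult_mono divide_left_mono) auto
  ultimately have t: "s / 2 \<le> t" by linarith
  have "t \<le> pi / 2" by (simp add: t_def)
  \<comment> \<open>The square of 1.7 is 2.89, within the range of
    \<open>sin_ge_half\<close>.\<close>
  also have "pi / 2 \<le> 1.7" using pi_approx by simp
  finally have "t\<^sup>2 \<le> 1.7\<^sup>2" using t s by (intro power_mono) auto
  then have "t / 2 \<le> sin t" using t s by (intro sin_ge_half) (auto simp: power2_eq_square)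
  moreover have "sin t = cos \<bar>\<theta> * x\<bar>" unfolding t_def by (simp add: sin_diff)
  ultimately show ?thesis using t by simp
qed

text \<open>The additive error \<open>e\<close> of a step becomes a relative one: the cosine is at
  least s/4 on the strip, so \<open>e\<close> is at most 4e/s times the cosine.\<close>

lemma killed_cos_decay:
  assumes b: "0 < b" and s: "0 < s" "s \<le> 1" and th: "\<theta> = pi / (2 * (b * (1 + s)))"
  defines "L \<equiv> \<theta>\<^sup>2 * \<sigma>\<^sup>2 / 2"
    and "e \<equiv> 17 * moment * (1 / (b * s)) powr (2 + \<eta>)"
  shows "killed_expectation b (bump 0 \<theta>) n \<le> exp (real n * (- L + 4 * e / s))"
proof (induction n)
  case 0
  then show ?case by (simp add: killed_expectation_0 bump_def)
next
  case (Suc n)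
  have e0: "0 \<le> e" unfolding e_def using moment_nonneg by simp
  define \<rho> where "\<rho> = exp (- L + 4 * e / s)"
  have "killed_expectation b (bump 0 \<theta>) (Suc n) \<le> killed_expectation b (\<lambda>x. \<rho> * bump 0 \<theta> x) n"
  proof (rule killed_expectation_Suc_le[where B = 2 and C = "\<rho> * 2"])
    fix x :: real
    show "\<bar>bump 0 \<theta> x\<bar> \<le> 2" by (rule abs_bump_le) simp
    then show "\<bar>\<rho> * bump 0 \<theta> x\<bar> \<le> \<rho> * 2" by (simp add: abs_mult \<rho>_def)
  next
    fix x assume x: "\<bar>x\<bar> \<le> b"
    let ?c = "cos (\<theta> * x)"
    have c: "s / 4 \<le> ?c" by (rule cos_lower_on_strip[OF b s th x])
    have "(\<integral>\<omega>. bump 0 \<theta> (x + X \<omega>) * indicator {-b..b} (x + X \<omega>) \<partial>M) \<le> ?c - L * ?c + e"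
      using killed_bump_upper[OF b s th, of 0 x] x by (simp add: L_def e_def bump_def)
    also have "e \<le> 4 * e / s * ?c"
      using mult_left_mono[OF c, of "4 * e / s"] e0 s by simp
    also have "?c - L * ?c + 4 * e / s * ?c = (1 + (- L + 4 * e / s)) * ?c"
      by (simp add: algebra_simps)
    also have "\<dots> \<le> \<rho> * ?c"
      unfolding \<rho>_def using c s by (intro mult_right_mono exp_ge_add_one_self) auto
    finally show "(\<integral>\<omega>. bump 0 \<theta> (x + X \<omega>) * indicator {-b..b} (x + X \<omega>) \<partial>M) \<le> \<rho> * bump 0 \<theta> x"
      by (simp add: bump_def)
  qed (use b in auto)
  also have "\<dots> \<le> \<rho> * exp (real n * (- L + 4 * e / s))"
    unfolding killed_expectation_cmult by (intro mult_left_mono Suc) (simp add: \<rho>_def)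
  also have "\<dots> = exp (real (Suc n) * (- L + 4 * e / s))"
    unfolding \<rho>_def by (simp add: exp_add[symmetric] algebra_simps add_divide_distrib)
  finally show ?case .
qed

text \<open>Bounding the indicator of the strip by a multiple of the cosine would lose a factor 1/s.
  Instead the expectation of cos - cos^2/4, at most that of the cosine at time \<open>m\<close>,
  stays nonnegative while it drops at each of \<open>j\<close> further steps.\<close>

lemma prob_stays_le:
  assumes b: "0 < b" and s: "0 < s" "s \<le> 1" and th: "\<theta> = pi / (2 * (b * (1 + s)))"
  defines "L \<equiv> \<theta>\<^sup>2 * \<sigma>\<^sup>2 / 2"
    and "e \<equiv> 17 * moment * (1 / (b * s)) powr (2 + \<eta>)"
  assumes eL: "e \<le> L / 4"
  shows "L / 4 * real j * prob (stays b (m + j)) \<le> exp (real m * (- L + 4 * e / s))"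
proof -
  let ?u = "bump (-1/4) \<theta>"
  have u2: "\<bar>?u x\<bar> \<le> 2" for x by (rule abs_bump_le) simp
  have L0: "0 \<le> L" by (simp add: L_def)
  \<comment> \<open>With \<epsilon> = -1/4 the drift is -L/2 - L(c - c^2) \<le> -L/2, and the error
    takes back at most L/4.\<close>
  have step: "killed_expectation b ?u (Suc n) \<le> killed_expectation b ?u n - L / 4 * prob (stays b n)" for n
  proof -
    have "killed_expectation b ?u (Suc n) \<le> killed_expectation b (\<lambda>x. ?u x + (- (L / 4))) n"
    proof (rule killed_expectation_Suc_le[where B = 2 and C = "2 + L / 4"])
      fix x :: real
      show "\<bar>?u x\<bar> \<le> 2" by (rule u2)
      then show "\<bar>?u x + (- (L / 4))\<bar> \<le> 2 + L / 4" using L0 by linarith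
    next
      fix x assume x: "\<bar>x\<bar> \<le> b"
      let ?c = "cos (\<theta> * x)"
      have "s / 4 \<le> ?c" by (rule cos_lower_on_strip[OF b s th x])
      then have c0: "0 \<le> ?c" using s by linarith
      have "?c\<^sup>2 \<le> ?c" using mult_left_mono[OF cos_le_one c0] by (simp add: power2_eq_square)
      then have "L * ?c\<^sup>2 \<le> L * ?c" using L0 by (rule mult_left_mono)
      moreover have "(\<integral>\<omega>. ?u (x + X \<omega>) * indicator {-b..b} (x + X \<omega>) \<partial>M)
          \<le> ?u x - L * ?c + (-1/4) * L * (2 - 4 * ?c\<^sup>2) + e"
        using killed_bump_upper[OF b s th _ x, of "-1/4"] by (simp add: L_def e_def)
      ultimately show "(\<integral>\<omega>. ?u (x + X \<omega>) * indicator {-b..b} (x + X \<omega>) \<partial>M) \<le> ?u x + (- (L / 4))"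
        using eL by (simp add: algebra_simps)
    qed (use b in auto)
    also have "\<dots> = killed_expectation b ?u n - L / 4 * prob (stays b n)"
    proof -
      have "killed_expectation b (\<lambda>x. ?u x + (- (L / 4))) n
          = killed_expectation b ?u n + killed_expectation b (\<lambda>_. - (L / 4)) n"
        unfolding killed_expectation_def distrib_right
        by (intro Bochner_Integration.integral_add integrable_killed[where B = 2]
            integrable_killed[where B = "L / 4"] u2) (use L0 in auto)
      then show ?thesis by (simp add: killed_expectation_const)
    qed
    finally show ?thesis .
  qed
  \<comment> \<open>The events decrease in time, so each of the \<open>j\<close> drops is at least
    L/4 times the final probability.\<close>
  have tele: "killed_expectation b ?u (m + j) + L / 4 * real j * prob (stays b (m + j)) \<le> killed_expectation b ?u m" for j
  proof (induction j)
    case 0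
    then show ?case by simp
  next
    case (Suc j)
    have "L / 4 * (real (Suc j) * prob (stays b (m + Suc j))) \<le> L / 4 * (real (Suc j) * prob (stays b (m + j)))"
      using L0 by (intro mult_left_mono finite_measure_mono stays_antimono sets_stays) auto
    with Suc step[of "m + j"] show ?case by (simp add: algebra_simps add_divide_distrib)
  qed
  have cb: "0 \<le> cos (\<theta> * x)" if "\<bar>x\<bar> \<le> b" for x
    using cos_lower_on_strip[OF b s th that] s by linarith
  have "0 \<le> killed_expectation b ?u (m + j)"
  proof -
    have "killed_expectation b (\<lambda>_. 0) (m + j) \<le> killed_expectation b ?u (m + j)"
    proof (rule killed_expectation_mono[where B = 0 and C = 2])
      fix x assume "\<bar>x\<bar> \<le> b"
      then show "0 \<le> ?u x"
        unfolding bump_factor using cb one_plus_small_cos_nonneg[of "-1/4"]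
        by (intro mult_nonneg_nonneg) auto
    qed (use b u2 in auto)
    then show ?thesis by (simp add: killed_expectation_const)
  qed
  moreover have "killed_expectation b ?u m \<le> killed_expectation b (bump 0 \<theta>) m"
    by (rule killed_expectation_mono[where B = 2 and C = 2])
      (use b u2 abs_bump_le[of 0] in \<open>auto simp: bump_def\<close>)
  moreover have "killed_expectation b (bump 0 \<theta>) m \<le> exp (real m * (- L + 4 * e / s))"
    unfolding L_def e_def by (rule killed_cos_decay[OF b s th])
  ultimately show ?thesis using tele[of j] by linarith
qed

text \<open>Near the edge the cosine vanishes and cannot absorb an additive error, but the drift of
  \<epsilon> cos^2 is about 2\<epsilon>L there. The price is a decay rate larger by the factor 1 +
  3\<epsilon>.\<close>

lemma prob_stays_ge:
  assumes b: "0 < b" and th: "\<theta> = pi / (2 * b)"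
  defines "L \<equiv> \<theta>\<^sup>2 * \<sigma>\<^sup>2 / 2" and "\<epsilon> \<equiv> 17 * moment * \<theta> powr \<eta> / \<sigma>\<^sup>2"
  assumes e1: "\<epsilon> \<le> 1" and t1: "L * (1 + 3 * \<epsilon>) \<le> 1"
  shows "(1 - L * (1 + 3 * \<epsilon>)) ^ n \<le> 2 * prob (stays b n)"
proof -
  let ?t = "L * (1 + 3 * \<epsilon>)"
  let ?g = "bump \<epsilon> \<theta>"
  have th0: "0 < \<theta>" using b by (simp add: th)
  have thb: "\<theta> * b = pi / 2" using b by (simp add: th)
  have e0: "0 \<le> \<epsilon>" unfolding \<epsilon>_def using moment_nonneg by simp
  have L0: "0 \<le> L" by (simp add: L_def)
  have e1': "\<bar>\<epsilon>\<bar> \<le> 1" using e0 e1 by simp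
  have g2: "\<bar>?g x\<bar> \<le> 2" for x by (rule abs_bump_le[OF e1'])
  \<comment> \<open>\<epsilon> is chosen to make the constant part 2\<epsilon>L of the drift cancel
    the error of one step.\<close>
  have err: "2 * \<epsilon> * L = 17 * moment * \<theta> powr (2 + \<eta>)"
    using sigma_pos th0 by (simp add: \<epsilon>_def L_def powr_add powr_numeral)
  have "(1 - ?t) ^ n \<le> killed_expectation b ?g n"
  proof (induction n)
    case 0
    then show ?case using e0 by (simp add: killed_expectation_0 bump_def)
  next
    case (Suc n)
    have "(1 - ?t) ^ Suc n \<le> (1 - ?t) * killed_expectation b ?g n"
      using Suc t1 by (simp add: mult_left_mono)
    also have "\<dots> = killed_expectation b (\<lambda>x. (1 - ?t) * ?g x) n"
      by (rule killed_expectation_cmult[symmetric])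
    also have "\<dots> \<le> killed_expectation b ?g (Suc n)"
    proof (rule killed_expectation_Suc_ge[where B = 2 and C = "(1 - ?t) * 2"])
      fix x :: real
      show "\<bar>?g x\<bar> \<le> 2" by (rule g2)
      then show "\<bar>(1 - ?t) * ?g x\<bar> \<le> (1 - ?t) * 2"
        unfolding abs_mult using t1 by (intro mult_mono) auto
    next
      fix x assume x: "\<bar>x\<bar> \<le> b"
      define c where "c = cos (\<theta> * x)"
      have "\<bar>\<theta> * x\<bar> \<le> pi / 2" using th0 thb x by (intro abs_arg_le_half_pi[of \<theta> b]) auto
      then have c0: "0 \<le> c" unfolding c_def by (intro cos_ge_zero) auto
      have c1: "c \<le> 1" by (simp add: c_def)
      have "c\<^sup>2 \<le> c" using mult_left_mono[OF c1 c0] by (simp add: power2_eq_square)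
      then have "0 \<le> (\<epsilon> * L) * (3 * (c - c\<^sup>2) + 3 * \<epsilon> * c\<^sup>2)"
        using e0 L0 by (intro mult_nonneg_nonneg add_nonneg_nonneg) auto
      also have "\<dots> = (?g x - L * c + \<epsilon> * L * (2 - 4 * c\<^sup>2) - 2 * \<epsilon> * L) - (1 - ?t) * ?g x"
        unfolding bump_def c_def[symmetric] by (simp add: algebra_simps power2_eq_square)
      finally have "(1 - ?t) * ?g x \<le> ?g x - L * c + \<epsilon> * L * (2 - 4 * c\<^sup>2) - 17 * moment * \<theta> powr (2 + \<eta>)"
        unfolding err by simp
      also have "\<dots> \<le> (\<integral>\<omega>. ?g (x + X \<omega>) * indicator {-b..b} (x + X \<omega>) \<partial>M)"
        unfolding L_def c_def by (rule killed_bump_lower[OF b th e1' x])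
      finally show "(1 - ?t) * ?g x \<le> (\<integral>\<omega>. ?g (x + X \<omega>) * indicator {-b..b} (x + X \<omega>) \<partial>M)" .
    qed (use b in auto)
    finally show ?case .
  qed
  also have "\<dots> \<le> killed_expectation b (\<lambda>_. 2) n"
    by (rule killed_expectation_mono[where B = 2 and C = 2])
      (use b g2 in \<open>auto intro: order_trans[OF abs_ge_self]\<close>)
  finally show ?thesis by (simp add: killed_expectation_const)
qed

subsection \<open>Small ball probabilities\<close>

definition critical_radius :: "real \<Rightarrow> nat \<Rightarrow> real" where
  "critical_radius p n = \<sigma> * sqrt (pi\<^sup>2 * real n / (8 * p))"

text \<open>The frequency at which L = p/n. Its cosine first vanishes at
  \<open>critical_radius p n\<close>, which explains the constant pi^2/8 in the radius.\<close>

definition critical_freq :: "real \<Rightarrow> nat \<Rightarrow> real" where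
  "critical_freq p n = sqrt (2 * p / real n) / \<sigma>"

lemma critical_freq_eq:
  assumes "0 < n" "0 < p"
  shows "critical_freq p n = pi / (2 * critical_radius p n)"
proof -
  have "critical_radius p n * critical_freq p n = sqrt (pi\<^sup>2 * real n / (8 * p) * (2 * p / real n))"
    using sigma_pos by (simp add: critical_radius_def critical_freq_def real_sqrt_mult[symmetric])
  also have "pi\<^sup>2 * real n / (8 * p) * (2 * p / real n) = (pi / 2)\<^sup>2"
    using assms by (simp add: field_simps power2_eq_square)
  finally have "critical_radius p n * critical_freq p n = pi / 2" by simp
  moreover have "0 < critical_radius p n"
    using assms sigma_pos by (simp add: critical_radius_def)
  ultimately show ?thesis by (simp add: field_simps)
qed

lemma critical_freq_sq:
  assumes "0 < n" "0 < p"
  shows "(critical_freq p n)\<^sup>2 = 2 * p / (real n * \<sigma>\<^sup>2)"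
  using assms by (simp add: critical_freq_def power_divide)

text \<open>With s = 1/p this is, up to constants, \<open>n * p\<close> times a bound for the error
  of one step. If it is at most 1, the relative error 4e/s is of order 1/n and costs only a constant
  over \<open>n\<close> steps; 1000 leaves slack.\<close>

definition error_budget :: "real \<Rightarrow> nat \<Rightarrow> real" where
  "error_budget p n = 1000 * moment * real n * p * (critical_freq p n * p) powr (2 + \<eta>)"

lemma small_ball_upper:
  assumes n: "0 < n" and p: "1 \<le> p" and pn: "p \<le> real n"
    and small: "error_budget p n \<le> 1"
  shows "prob (stays (critical_radius p n) n) \<le> 16 * exp 5 * exp (- p)"
proof -
  define b where "b = critical_radius p n"
  define \<tau> where "\<tau> = critical_freq p n"
  \<comment> \<open>This widening lowers L by at most 2/n, hence costs at most a factor
    \<open>exp 2\<close> over the whole time.\<close>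
  define s where "s = 1 / p"
  define \<theta> where "\<theta> = pi / (2 * (b * (1 + s)))"
  define L where "L = \<theta>\<^sup>2 * \<sigma>\<^sup>2 / 2"
  define e where "e = 17 * moment * (1 / (b * s)) powr (2 + \<eta>)"
  \<comment> \<open>About n/p final steps: enough for L j to be bounded below, few enough to forgo
    only a constant factor of decay.\<close>
  define j where "j = nat \<lceil>real n / p\<rceil>"
  define m where "m = n - j"
  have b: "0 < b" using n p sigma_pos by (simp add: b_def critical_radius_def)
  have s: "0 < s" "s \<le> 1" using p by (simp_all add: s_def)
  have tb: "\<tau> = pi / (2 * b)" unfolding \<tau>_def b_def using n p by (intro critical_freq_eq) auto
  have t0: "0 < \<tau>" using b by (simp add: tb)
  have "\<theta> = \<tau> / (1 + s)" by (simp add: \<theta>_def tb)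
  then have Leq: "L = p / real n * (1 / (1 + s)\<^sup>2)"
    using critical_freq_sq[of n p] n p sigma_pos
    by (simp add: L_def \<tau>_def[symmetric] power_divide)
  have pn0: "0 < p / real n" using n p by simp
  have "1 / 4 \<le> 1 / (1 + s)\<^sup>2"
  proof -
    have "(1 + s)\<^sup>2 \<le> 2\<^sup>2" using s by (intro power_mono) auto
    then show ?thesis using s by (intro divide_left_mono) auto
  qed
  then have "p / real n * (1 / 4) \<le> L"
    unfolding Leq using pn0 by (intro mult_left_mono) auto
  then have L4: "p / real n / 4 \<le> L" by simp
  have "1 - 2 * s \<le> 1 / (1 + s)\<^sup>2"
  proof -
    have "(1 - 2 * s) * (1 + s)\<^sup>2 = 1 - (3 * s\<^sup>2 + 2 * s ^ 3)"
      by (simp add: power2_eq_square power3_eq_cube algebra_simps)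
    also have "\<dots> \<le> 1" using s zero_le_power[of s 3] zero_le_power2[of s] by linarith
    finally show ?thesis using s by (simp add: field_simps)
  qed
  then have "p / real n * (1 - 2 * s) \<le> L"
    unfolding Leq using pn0 by (intro mult_left_mono) auto
  moreover have "p / real n * (1 - 2 * s) = p / real n - 2 / real n"
    using p n by (simp add: s_def right_diff_distrib)
  ultimately have L2: "p / real n - 2 / real n \<le> L" by simp
  have e_le: "e \<le> 17 / 1000 / (real n * p)"
  proof -
    have "1 / (b * s) = 2 / pi * (\<tau> * p)"
      using b p by (simp add: tb s_def)
    also have "\<dots> \<le> 1 * (\<tau> * p)"
      using t0 p pi_ge_two by (intro mult_right_mono) auto
    finally have "(1 / (b * s)) powr (2 + \<eta>) \<le> (\<tau> * p) powr (2 + \<eta>)"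
      using b s eta_pos by (intro powr_mono2) auto
    then have "e \<le> 17 * moment * (\<tau> * p) powr (2 + \<eta>)"
      unfolding e_def using moment_nonneg by (intro mult_left_mono) auto
    also have "\<dots> = 17 / 1000 / (real n * p) * error_budget p n"
      using n p by (simp add: error_budget_def \<tau>_def)
    also have "\<dots> \<le> 17 / 1000 / (real n * p) * 1"
      using small n p by (intro mult_left_mono) auto
    finally show ?thesis by simp
  qed
  have eL: "e \<le> L / 4"
  proof -
    have "real n * 1 \<le> real n * p" using p by (intro mult_left_mono) auto
    then have "17 / 1000 / (real n * p) \<le> 17 / 1000 / (real n * 1)"
      using n by (intro divide_left_mono) auto
    also have "\<dots> \<le> (1 / 16) / real n" by (simp add: divide_simps)
    also have "\<dots> \<le> (p / 16) / real n" using p by (intro divide_right_mono) auto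
    also have "\<dots> = p / real n / 4 / 4" by simp
    also have "\<dots> \<le> L / 4" using L4 by (intro divide_right_mono) auto
    finally show ?thesis using e_le by (rule order_trans[rotated])
  qed
  have es: "4 * e / s \<le> 1 / real n"
  proof -
    have "4 * e / s = 4 * p * e" by (simp add: s_def)
    also have "\<dots> \<le> 4 * p * (17 / 1000 / (real n * p))"
      using e_le p by (intro mult_left_mono) auto
    also have "\<dots> = 68 / 1000 / real n" using p by simp
    also have "\<dots> \<le> 1 / real n" by (intro divide_right_mono) auto
    finally show ?thesis .
  qed
  have j1: "real n / p \<le> real j" unfolding j_def by (rule of_nat_ceiling)
  have j2: "real j \<le> real n / p + 1"
    unfolding j_def using n p of_int_ceiling_le_add_one[of "real n / p"] by (simp add: of_nat_nat)
  have jn: "j \<le> n"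
  proof -
    have "real n / p \<le> real n" using n p by (simp add: divide_le_eq)
    then show ?thesis unfolding j_def by (simp add: ceiling_le_iff nat_le_iff)
  qed
  have main: "L / 4 * real j * prob (stays b (m + j)) \<le> exp (real m * (- L + 4 * e / s))"
    unfolding L_def e_def by (rule prob_stays_le[OF b s \<theta>_def]) (use eL in \<open>simp add: L_def e_def\<close>)
  have Lj: "1 / 16 \<le> L / 4 * real j"
  proof -
    have "1 / 16 = p / real n / 4 / 4 * (real n / p)" using n p by simp
    also have "\<dots> \<le> L / 4 * real j"
      using L4 j1 n p by (intro mult_mono) (auto simp: L_def)
    finally show ?thesis .
  qed
  have "3 / real n = 2 / real n + 1 / real n" by (simp add: add_divide_distrib[symmetric])
  then have "- L + 4 * e / s \<le> - (p / real n) + 3 / real n" using L2 es by linarith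
  then have "real m * (- L + 4 * e / s) \<le> real m * (- (p / real n) + 3 / real n)"
    by (intro mult_left_mono) auto
  \<comment> \<open>The forgone decay of the last \<open>j\<close> steps is at most 2. The 3
    consists of 2 from the widening and 1 from the step errors, which gives
    \<open>exp 5\<close>.\<close>
  also have "\<dots> = - p + real j * (p / real n) + 3 * (real m / real n)"
    using jn n by (simp add: m_def of_nat_diff field_simps)
  also have "\<dots> \<le> - p + 2 + 3 * 1"
  proof -
    have "real j * (p / real n) \<le> (real n / p + 1) * (p / real n)"
      using j2 pn0 by (intro mult_right_mono) auto
    also have "\<dots> = 1 + p / real n" using n p by (simp add: field_simps)
    also have "\<dots> \<le> 2" using pn n by simp
    finally have "real j * (p / real n) \<le> 2" .
    moreover have "real m / real n \<le> 1" using n by (simp add: m_def)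
    ultimately show ?thesis by linarith
  qed
  finally have "exp (real m * (- L + 4 * e / s)) \<le> exp (5 + - p)" by simp
  from order_trans[OF main this] have "L / 4 * real j * prob (stays b n) \<le> exp 5 * exp (- p)"
    using jn unfolding exp_add by (simp add: m_def)
  moreover have "1 / 16 * prob (stays b n) \<le> L / 4 * real j * prob (stays b n)"
    using Lj by (intro mult_right_mono) auto
  ultimately show ?thesis unfolding b_def by linarith
qed

text \<open>The strip is not widened, so L is exactly p/n. The bound 4p^2 \<le> n controls the
  second order term when the power (1 - t)^n is compared with an exponential.\<close>

lemma small_ball_lower:
  assumes n: "0 < n" and p: "1 \<le> p" and pn: "4 * p\<^sup>2 \<le> real n"
    and small: "error_budget p n \<le> 1"
  shows "exp (- p) \<le> 2 * exp 3 * prob (stays (critical_radius p n) n)"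
proof -
  define b where "b = critical_radius p n"
  define \<tau> where "\<tau> = critical_freq p n"
  define L where "L = \<tau>\<^sup>2 * \<sigma>\<^sup>2 / 2"
  define \<epsilon> where "\<epsilon> = 17 * moment * \<tau> powr \<eta> / \<sigma>\<^sup>2"
  define t where "t = L * (1 + 3 * \<epsilon>)"
  have b: "0 < b" using n p sigma_pos by (simp add: b_def critical_radius_def)
  have tb: "\<tau> = pi / (2 * b)" unfolding \<tau>_def b_def using n p by (intro critical_freq_eq) auto
  have t0: "0 < \<tau>" using b by (simp add: tb)
  have tsq: "\<tau>\<^sup>2 = 2 * p / (real n * \<sigma>\<^sup>2)"
    unfolding \<tau>_def using n p by (intro critical_freq_sq) auto
  have Leq: "L = p / real n"
    unfolding L_def tsq using sigma_pos by simp
  have e0: "0 \<le> \<epsilon>" unfolding \<epsilon>_def using moment_nonneg by simp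
  \<comment> \<open>Inserting \<tau>^2 = 2p/(n \<sigma>^2) expresses the correction \<epsilon>
    through the error budget and shows that \<epsilon> p is at most 1/3.\<close>
  have "2000 / 17 * (\<epsilon> * p\<^sup>2) = 1000 * moment * real n * p * (\<tau>\<^sup>2 * \<tau> powr \<eta>)"
    unfolding tsq \<epsilon>_def using n sigma_pos by (simp add: field_simps power2_eq_square)
  also have "\<tau>\<^sup>2 * \<tau> powr \<eta> = \<tau> powr (2 + \<eta>)"
    using t0 by (simp add: powr_add powr_numeral)
  also have "1000 * moment * real n * p * \<dots> \<le> 1000 * moment * real n * p * (\<tau> * p) powr (2 + \<eta>)"
    using t0 p eta_pos moment_nonneg by (intro mult_left_mono powr_mono2) auto
  also have "\<dots> \<le> 1" using small by (simp add: error_budget_def \<tau>_def)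
  finally have ep2: "2000 / 17 * (\<epsilon> * p\<^sup>2) \<le> 1" .
  have pp: "p \<le> p\<^sup>2" using p by (simp add: power2_eq_square)
  have "\<epsilon> * p \<le> \<epsilon> * p\<^sup>2" using pp e0 by (rule mult_left_mono)
  then have ep: "3 * (\<epsilon> * p) \<le> 1" using ep2 by linarith
  have "\<epsilon> * 1 \<le> \<epsilon> * p" using p e0 by (rule mult_left_mono)
  then have e1: "\<epsilon> \<le> 1" using ep by linarith
  have tn: "real n * t = p + 3 * (\<epsilon> * p)"
    unfolding t_def Leq using n by (simp add: field_simps)
  have tle: "t \<le> 2 * p / real n"
  proof -
    have "real n * t \<le> 2 * p" using tn ep p by linarith
    then show ?thesis using n by (simp add: pos_le_divide_eq mult.commute)
  qed
  have tge: "0 \<le> t" unfolding t_def Leq using p e0 by simp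
  have thalf: "t \<le> 1 / 2"
  proof -
    have "2 * p / real n \<le> 1 / 2" using pp pn n by (simp add: field_simps)
    then show ?thesis using tle by linarith
  qed
  have tt: "real n * t\<^sup>2 \<le> 1"
  proof -
    have "t\<^sup>2 \<le> (2 * p / real n)\<^sup>2" using tle tge by (intro power_mono) auto
    then have "real n * t\<^sup>2 \<le> real n * (2 * p / real n)\<^sup>2" by (intro mult_left_mono) auto
    also have "\<dots> = 4 * p\<^sup>2 / real n" using n by (simp add: power2_eq_square)
    also have "\<dots> \<le> 1" using pn n by simp
    finally show ?thesis .
  qed
  \<comment> \<open>The loss 3 is 1 from 3 \<epsilon> p and 2 from 2 n t^2.\<close>
  have "- p - 3 \<le> real n * (- t - 2 * t\<^sup>2)"
    using tn ep tt by (simp add: algebra_simps)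
  also have "\<dots> \<le> real n * ln (1 - t)"
    using tge thalf by (intro mult_left_mono ln_one_minus_pos_lower_bound) auto
  finally have "exp (- p - 3) \<le> exp (real n * ln (1 - t))" by simp
  also have "\<dots> = (1 - t) ^ n"
    using thalf by (simp add: exp_of_nat_mult)
  also have "\<dots> \<le> 2 * prob (stays b n)"
    unfolding t_def L_def \<epsilon>_def
    by (rule prob_stays_ge[OF b tb]) (use e1 thalf in \<open>simp_all add: t_def L_def \<epsilon>_def\<close>)
  finally have "exp (- p - 3) \<le> 2 * prob (stays b n)" .
  then have "exp 3 * exp (- p - 3) \<le> exp 3 * (2 * prob (stays b n))" by (intro mult_left_mono) auto
  then show ?thesis by (simp add: exp_add[symmetric] b_def mult_ac)
qed

text \<open>The budget grows with \<open>p\<close>, so the largest \<open>p\<close> decides. There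
  the exponent of \<open>n\<close> is -\<eta>/6 + \<eta>^2/8, which is at most -\<eta>/24 since
  \<eta> < 1.\<close>

lemma error_budget_small:
  assumes "0 < n" "1 \<le> p" "p \<le> real n powr (\<eta> / 12)"
  shows "error_budget p n \<le> 1000 * moment * (sqrt 2 / \<sigma>) powr (2 + \<eta>) * real n powr (- \<eta> / 24)"
proof -
  define y where "y = real n powr (\<eta> / 12)"
  have n1: "1 \<le> real n" using assms by simp
  have y: "p \<le> y" "1 \<le> y" using assms by (simp_all add: y_def)
  have "critical_freq p n * p \<le> critical_freq y n * y"
    unfolding critical_freq_def using y assms sigma_pos
    by (intro mult_mono divide_right_mono real_sqrt_le_mono) auto
  also have "critical_freq y n * y = sqrt 2 / \<sigma> * real n powr (\<eta> / 8 - 1 / 2)"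
  proof -
    have "sqrt (2 * y / real n) = sqrt 2 * (real n powr (\<eta> / 12 - 1)) powr (1 / 2)"
      using n1 by (simp add: y_def powr_half_sqrt powr_diff real_sqrt_divide real_sqrt_mult)
    also have "\<dots> = sqrt 2 * real n powr (\<eta> / 24 - 1 / 2)"
      by (simp add: powr_powr field_simps)
    finally have "critical_freq y n * y = sqrt 2 / \<sigma> * (real n powr (\<eta> / 24 - 1 / 2) * real n powr (\<eta> / 12))"
      by (simp add: critical_freq_def y_def)
    then show ?thesis by (simp add: powr_add[symmetric])
  qed
  finally have "(critical_freq p n * p) powr (2 + \<eta>)
      \<le> (sqrt 2 / \<sigma> * real n powr (\<eta> / 8 - 1 / 2)) powr (2 + \<eta>)"
    using assms sigma_pos eta_pos by (intro powr_mono2) (auto simp: critical_freq_def)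
  also have "\<dots> = (sqrt 2 / \<sigma>) powr (2 + \<eta>) * real n powr ((\<eta> / 8 - 1 / 2) * (2 + \<eta>))"
    unfolding powr_mult powr_powr ..
  finally have A: "(critical_freq p n * p) powr (2 + \<eta>)
      \<le> (sqrt 2 / \<sigma>) powr (2 + \<eta>) * real n powr ((\<eta> / 8 - 1 / 2) * (2 + \<eta>))" .
  have "error_budget p n = 1000 * moment * (real n * p * (critical_freq p n * p) powr (2 + \<eta>))"
    by (simp add: error_budget_def)
  also have "\<dots> \<le> 1000 * moment * (real n * y *
      ((sqrt 2 / \<sigma>) powr (2 + \<eta>) * real n powr ((\<eta> / 8 - 1 / 2) * (2 + \<eta>))))"
    using y A n1 moment_nonneg assms by (intro mult_left_mono mult_mono) auto
  also have "\<dots> = 1000 * moment * (sqrt 2 / \<sigma>) powr (2 + \<eta>) *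
      (real n powr 1 * real n powr (\<eta> / 12) * real n powr ((\<eta> / 8 - 1 / 2) * (2 + \<eta>)))"
    using n1 by (simp add: y_def)
  also have "real n powr 1 * real n powr (\<eta> / 12) * real n powr ((\<eta> / 8 - 1 / 2) * (2 + \<eta>))
      = real n powr (1 + \<eta> / 12 + (\<eta> / 8 - 1 / 2) * (2 + \<eta>))"
    by (simp only: powr_add)
  also have "\<dots> \<le> real n powr (- \<eta> / 24)"
  proof (rule powr_mono)
    have "\<eta> * \<eta> \<le> 1 * \<eta>" using eta_pos eta_less by (intro mult_right_mono) auto
    moreover have "1 + \<eta> / 12 + (\<eta> / 8 - 1 / 2) * (2 + \<eta>) = - \<eta> / 6 + \<eta> * \<eta> / 8"
      by (simp add: field_simps)
    ultimately show "1 + \<eta> / 12 + (\<eta> / 8 - 1 / 2) * (2 + \<eta>) \<le> - \<eta> / 24"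
      by linarith
  qed (use n1 in auto)
  finally show ?thesis using moment_nonneg by (simp add: mult_left_mono)
qed

text \<open>The threshold for \<open>n\<close> is uniform in \<open>p\<close>, so \<open>p\<close>
  may later vary with \<open>n\<close>. In this range p^2 is at most n^(1/6).\<close>

lemma eventually_good_range:
  "\<forall>\<^sub>F n in sequentially. \<forall>p. 1 \<le> p \<longrightarrow> p \<le> real n powr (\<eta> / 12) \<longrightarrow>
     p \<le> real n \<and> 4 * p\<^sup>2 \<le> real n \<and> error_budget p n \<le> 1"
proof -
  let ?K = "1000 * moment * (sqrt 2 / \<sigma>) powr (2 + \<eta>)"
  have "((\<lambda>n. ?K * real n powr (- \<eta> / 24)) \<longlongrightarrow> ?K * 0) sequentially"
    using eta_pos by (intro tendsto_mult tendsto_const tendsto_neg_powr filterlim_real_sequentially) auto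
  then have "\<forall>\<^sub>F n in sequentially. ?K * real n powr (- \<eta> / 24) < 1"
    by (rule order_tendstoD(2)) simp
  moreover have "((\<lambda>n. 4 * real n powr (- (5 / 6))) \<longlongrightarrow> 4 * 0) sequentially"
    by (intro tendsto_mult tendsto_const tendsto_neg_powr filterlim_real_sequentially) auto
  then have "\<forall>\<^sub>F n in sequentially. 4 * real n powr (- (5 / 6)) < 1"
    by (rule order_tendstoD(2)) simp
  ultimately show ?thesis
    using eventually_gt_at_top[of 0]
  proof eventually_elim
    case (elim n)
    have n1: "1 \<le> real n" using elim(3) by simp
    show ?case
    proof (intro allI impI)
      fix p :: real assume p: "1 \<le> p" "p \<le> real n powr (\<eta> / 12)"
      have "p\<^sup>2 \<le> (real n powr (\<eta> / 12))\<^sup>2" using p by (intro power_mono) auto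
      also have "\<dots> = real n powr (\<eta> / 6)"
        by (simp add: power2_eq_square powr_add[symmetric])
      also have "\<dots> \<le> real n powr (1 / 6)" using n1 eta_less by (intro powr_mono) auto
      also have "\<dots> = real n powr 1 * real n powr (- (5 / 6))"
        by (simp only: powr_add[symmetric]) simp
      finally have "4 * p\<^sup>2 \<le> real n * (4 * real n powr (- (5 / 6)))" by simp
      also have "\<dots> \<le> real n * 1" using elim(2) by (intro mult_left_mono) auto
      finally have 1: "4 * p\<^sup>2 \<le> real n" by simp
      moreover have "p \<le> p\<^sup>2" using p by (simp add: power2_eq_square)
      ultimately have "p \<le> real n" by linarith
      moreover have "error_budget p n \<le> 1"
        using error_budget_small[OF elim(3) p] elim(1) by linarith
      ultimately show "p \<le> real n \<and> 4 * p\<^sup>2 \<le> real n \<and> error_budget p n \<le> 1" using 1 by blast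
    qed
  qed
qed

lemma stays_mono: "b \<le> c \<Longrightarrow> stays b n \<subseteq> stays c n"
  by (force simp: stays_def)

lemma prob_stays_mono: "b \<le> c \<Longrightarrow> prob (stays b n) \<le> prob (stays c n)"
  by (intro finite_measure_mono stays_mono sets_stays)

lemma critical_radius_antimono:
  assumes "0 < p" "p \<le> q"
  shows "critical_radius q n \<le> critical_radius p n"
  unfolding critical_radius_def using assms sigma_pos
  by (intro mult_left_mono real_sqrt_le_mono divide_left_mono) auto

lemma stays_eq_max:
  assumes "1 \<le> n"
  shows "{\<omega> \<in> space M. max_abs_partial_sum Xs n \<omega> \<le> b} = stays b n"
  using assms by (auto simp: stays_def max_abs_partial_sum_def)

text \<open>Truncating \<open>p\<close> from below at \<open>1\<close> costs a constant, truncating it from above at a power of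
  \<open>n\<close> costs a summable error.\<close>

lemma small_ball_comparison:
  "\<exists>C>0. \<forall>\<^sub>F n in sequentially. \<forall>p>0.
     prob (stays (critical_radius p n) n) \<le> C * (exp (- p) + exp (- (real n powr (\<eta> / 12)))) \<and>
     exp (- p) \<le> C * (prob (stays (critical_radius p n) n) + exp (- (real n powr (\<eta> / 12))))"
proof -
  define C where "C = 16 * exp (5::real)"
  have C: "16 * exp 5 \<le> C" "2 * exp 3 \<le> C" "2 * exp 3 * exp 1 \<le> C" "1 \<le> C"  "0 < C" "exp 1 \<le> C"
  proof -
    have m: "exp 3 \<le> exp (5::real)" "1 \<le> exp (5::real)" "exp 1 \<le> exp (5::real)" "exp 4 \<le> exp (5::real)" by auto
    have "exp 3 * exp 1 = exp (4::real)" by (simp add: exp_add[symmetric])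
    then have "2 * exp 3 * exp 1 = 2 * exp (4::real)" by simp
    then show "16 * exp 5 \<le> C" "2 * exp 3 \<le> C" "2 * exp 3 * exp 1 \<le> C" "1 \<le> C"  "0 < C" "exp 1 \<le> C"
      unfolding C_def using m by linarith+
  qed
  have "\<forall>\<^sub>F n in sequentially. \<forall>p>0.
     prob (stays (critical_radius p n) n) \<le> C * (exp (- p) + exp (- (real n powr (\<eta> / 12)))) \<and>
     exp (- p) \<le> C * (prob (stays (critical_radius p n) n) + exp (- (real n powr (\<eta> / 12))))"
    using eventually_good_range eventually_gt_at_top[of 0]
  proof eventually_elim
    case (elim n)
    define y where "y = real n powr (\<eta> / 12)"
    have y1: "1 \<le> y" using elim(2) eta_pos by (simp add: y_def ge_one_powr_ge_zero)
    have up: "prob (stays (critical_radius q n) n) \<le> C * exp (- q)" if "1 \<le> q" "q \<le> y" for q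
      using small_ball_upper[of n q] elim that unfolding y_def C_def by auto
    have lo: "exp (- q) \<le> 2 * exp 3 * prob (stays (critical_radius q n) n)" if "1 \<le> q" "q \<le> y" for q
      using small_ball_lower[of n q] elim that unfolding y_def by auto
    show ?case
    proof (intro allI impI, fold y_def)
      fix p :: real assume p: "0 < p"
      let ?P = "prob (stays (critical_radius p n) n)"
      consider "p < 1" | "1 \<le> p" "p \<le> y" | "y < p" by linarith
      then show "?P \<le> C * (exp (- p) + exp (- y)) \<and> exp (- p) \<le> C * (?P + exp (- y))"
      proof cases
        case 1
        \<comment> \<open>For p < 1 both sides are of order one: the trivial bound serves above, and
          the smaller ball with p = 1 serves below.\<close>
        have "1 \<le> exp 1 * exp (- p)" using 1 by (simp add: exp_add[symmetric])
        then have "?P \<le> exp 1 * exp (- p)" using prob_le_1 by (rule order_trans[rotated])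
        also have "\<dots> \<le> C * (exp (- p) + exp (- y))" using C by (intro mult_mono) auto
        finally have a: "?P \<le> C * (exp (- p) + exp (- y))" .
        have "exp (- 1) \<le> 2 * exp 3 * prob (stays (critical_radius 1 n) n)" using y1 by (intro lo) auto
        also have "\<dots> \<le> 2 * exp 3 * ?P"
          using 1 p by (intro mult_left_mono prob_stays_mono critical_radius_antimono) auto
        finally have "exp 1 * exp (- 1) \<le> exp 1 * (2 * exp 3 * ?P)" by (intro mult_left_mono) auto
        then have "1 \<le> 2 * exp 3 * exp 1 * ?P" by (simp add: exp_add[symmetric] mult_ac)
        moreover have "exp (- p) \<le> 1" using p by simp
        ultimately have "exp (- p) \<le> 2 * exp 3 * exp 1 * ?P" by linarith
        also have "\<dots> \<le> C * (?P + exp (- y))" using C by (intro mult_mono) auto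
        finally show ?thesis using a by blast
      next
        case 2
        have "?P \<le> C * exp (- p)" by (rule up[OF 2])
        also have "\<dots> \<le> C * (exp (- p) + exp (- y))" using C by (intro mult_left_mono) auto
        finally have a: "?P \<le> C * (exp (- p) + exp (- y))" .
        have "exp (- p) \<le> 2 * exp 3 * ?P" by (rule lo[OF 2])
        also have "\<dots> \<le> C * (?P + exp (- y))" using C by (intro mult_mono) auto
        finally show ?thesis using a by blast
      next
        case 3
        \<comment> \<open>For p > y the ball lies inside the one for \<open>y\<close>, so both
          quantities are at most a constant times \<open>exp (- y)\<close>.\<close>
        have "?P \<le> prob (stays (critical_radius y n) n)"
          using 3 y1 by (intro prob_stays_mono critical_radius_antimono) auto
        also have "\<dots> \<le> C * exp (- y)" using y1 by (intro up) auto
        also have "\<dots> \<le> C * (exp (- p) + exp (- y))" using C by (intro mult_left_mono) auto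
        finally have a: "?P \<le> C * (exp (- p) + exp (- y))" .
        have "exp (- p) \<le> 1 * exp (- y)" using 3 by simp
        also have "\<dots> \<le> C * (?P + exp (- y))" using C by (intro mult_mono) auto
        finally show ?thesis using a by blast
      qed
    qed
  qed
  then show ?thesis using C by blast
qed

end

section \<open>Summation against the weights\<close>

lemma summable_on_eventually_le:
  fixes f g :: "nat \<Rightarrow> real"
  assumes g: "g summable_on {1..}" and f0: "\<And>n. 0 \<le> f n"
    and le: "\<forall>\<^sub>F n in sequentially. f n \<le> g n"
  shows "f summable_on {1..}"
proof -
  obtain N where N: "\<And>n. n \<ge> N \<Longrightarrow> f n \<le> g n" using le by (auto simp: eventually_sequentially)
  have "g summable_on {max 1 N..}" by (rule summable_on_subset_banach[OF g]) auto
  then have "f summable_on {max 1 N..}"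
    by (rule summable_on_comparison_test) (use N f0 in auto)
  then have "f summable_on ({max 1 N..} \<union> {1..<max 1 N})"
    by (rule summable_on_Un_disjoint) auto
  moreover have "{max 1 N..} \<union> {1..<max 1 N} = {1..}" by auto
  ultimately show ?thesis by simp
qed

text \<open>The stretched exponential beats every power of n and of the logarithm, so the terms are
  O(n^(-2)). The asymptotics use \<open>ln\<close>, which agrees with \<open>trunc_log\<close> from
  e on.\<close>

lemma summable_weight_stretched_exp:
  fixes q a g :: real
  assumes "0 < g"
  shows "(\<lambda>n. real n powr q * trunc_log (real n) powr a * exp (- (real n powr g))) summable_on {1::nat..}"
proof -
  have "(\<lambda>n::nat. real n powr q * ln (real n) powr a * exp (- (real n powr g))) \<in> O(\<lambda>n. real n powr (- 2))"
    using assms by real_asymp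
  then have "summable (\<lambda>n::nat. real n powr q * ln (real n) powr a * exp (- (real n powr g)))"
    by (rule summable_comparison_test_bigo[rotated]) (simp add: summable_real_powr_iff)
  then have "(\<lambda>n::nat. real n powr q * ln (real n) powr a * exp (- (real n powr g))) summable_on UNIV"
    by (subst summable_on_UNIV_nonneg_real_iff) auto
  then have "(\<lambda>n::nat. real n powr q * ln (real n) powr a * exp (- (real n powr g))) summable_on {1..}"
    by (rule summable_on_subset_banach) auto
  then show ?thesis
  proof (rule summable_on_eventually_le)
    show "\<forall>\<^sub>F n in sequentially. real n powr q * trunc_log (real n) powr a * exp (- (real n powr g))
        \<le> real n powr q * ln (real n) powr a * exp (- (real n powr g))"
      using eventually_ge_at_top[of "nat \<lceil>exp (1::real)\<rceil>"]
    proof eventually_elim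
      case (elim n)
      then have "exp 1 \<le> real n" by linarith
      then show ?case by (simp add: trunc_log_def max_def)
    qed
  qed auto
qed

text \<open>Used in both directions of the equivalence, with \<open>h\<close> the stretched
  exponential error.\<close>

lemma summable_on_weighted_comparison:
  fixes w f g h :: "nat \<Rightarrow> real"
  assumes w: "\<And>n. 0 \<le> w n" and f: "\<And>n. 0 \<le> f n"
    and g: "(\<lambda>n. w n * g n) summable_on {1..}" and h: "(\<lambda>n. w n * h n) summable_on {1..}"
    and le: "\<forall>\<^sub>F n in sequentially. f n \<le> C * (g n + h n)"
  shows "(\<lambda>n. w n * f n) summable_on {1..}"
proof (rule summable_on_eventually_le)
  show "(\<lambda>n. C * (w n * g n + w n * h n)) summable_on {1..}"
    by (intro summable_on_cmult_right summable_on_add g h)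
  show "\<forall>\<^sub>F n in sequentially. w n * f n \<le> C * (w n * g n + w n * h n)"
    using le
  proof eventually_elim
    case (elim n)
    then have "w n * f n \<le> w n * (C * (g n + h n))" using w by (rule mult_left_mono)
    then show ?case by (simp add: algebra_simps)
  qed
qed (use w f in auto)

text \<open>All terms are nonnegative, so failure of summability means divergence to infinity, and
  the equivalence contains both alternatives.\<close>

theorem theorem1p3:
  fixes M :: "'a measure"
    and X :: "'a \<Rightarrow> real"
    and Xs :: "nat \<Rightarrow> 'a \<Rightarrow> real"
    and r a \<sigma> \<eta> :: real
    and \<psi> :: "real \<Rightarrow> real"
  assumes "prob_space M"
    and "iid_copies M X Xs"
    and "r > 1"
    and "integrable M X" and "(\<integral>\<omega>. X \<omega> \<partial>M) = 0"
    and "integrable M (\<lambda>\<omega>. (X \<omega>)\<^sup>2)" and "(\<integral>\<omega>. (X \<omega>)\<^sup>2 \<partial>M) = \<sigma>\<^sup>2"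
    and "0 < \<sigma>"
    and "0 < \<eta>" and "\<eta> < 1"
    and "integrable M (\<lambda>\<omega>. \<bar>X \<omega>\<bar> powr (2 + \<eta>))"
    and "\<forall>x\<ge>1. 0 < \<psi> x"
    and "eventually_nondecreasing \<psi>"
  shows "(\<lambda>n. real n powr (r - 2) * trunc_log (real n) powr a *
              measure M {\<omega> \<in> space M. max_abs_partial_sum Xs n \<omega>
                           \<le> \<sigma> * sqrt (pi\<^sup>2 * real n / (8 * \<psi> (real n)))}) summable_on {1::nat..}
     \<longleftrightarrow> (\<lambda>n. real n powr (r - 2) * trunc_log (real n) powr a *
              exp (- \<psi> (real n))) summable_on {1::nat..}"
proof -
  interpret centered_walk M X Xs \<sigma> \<eta>
    using assms by (intro centered_walk.intro centered_walk_axioms.intro)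
  define w where "w n = real n powr (r - 2) * trunc_log (real n) powr a" for n
  define P where "P n = prob (stays (critical_radius (\<psi> (real n)) n) n)" for n
  obtain C where "\<forall>\<^sub>F n in sequentially. \<forall>p>0.
     prob (stays (critical_radius p n) n) \<le> C * (exp (- p) + exp (- (real n powr (\<eta> / 12)))) \<and>
     exp (- p) \<le> C * (prob (stays (critical_radius p n) n) + exp (- (real n powr (\<eta> / 12))))"
    using small_ball_comparison by blast
  \<comment> \<open>Uniformity in \<open>p\<close> permits the substitution of \<psi>(n), which is
    positive for n \<ge> 1.\<close>
  then have cmp: "\<forall>\<^sub>F n in sequentially.
     P n \<le> C * (exp (- \<psi> (real n)) + exp (- (real n powr (\<eta> / 12)))) \<and>
     exp (- \<psi> (real n)) \<le> C * (P n + exp (- (real n powr (\<eta> / 12))))"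
    using eventually_ge_at_top[of 1]
    by eventually_elim (use assms(12) in \<open>auto simp: P_def\<close>)
  have h: "(\<lambda>n. w n * exp (- (real n powr (\<eta> / 12)))) summable_on {1..}"
    unfolding w_def using eta_pos by (intro summable_weight_stretched_exp) auto
  have "(\<lambda>n. w n * P n) summable_on {1..} \<longleftrightarrow> (\<lambda>n. w n * exp (- \<psi> (real n))) summable_on {1..}"
  proof
    assume "(\<lambda>n. w n * P n) summable_on {1..}"
    from this h show "(\<lambda>n. w n * exp (- \<psi> (real n))) summable_on {1..}"
      by (rule summable_on_weighted_comparison[rotated 2])
        (use cmp in \<open>auto simp: w_def elim: eventually_mono\<close>)
  next
    assume "(\<lambda>n. w n * exp (- \<psi> (real n))) summable_on {1..}"
    from this h show "(\<lambda>n. w n * P n) summable_on {1..}"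
      by (rule summable_on_weighted_comparison[rotated 2])
        (use cmp in \<open>auto simp: w_def P_def elim: eventually_mono\<close>)
  qed
  moreover have "(\<lambda>n. w n * P n) summable_on {1..} \<longleftrightarrow>
    (\<lambda>n. w n * measure M {\<omega> \<in> space M. max_abs_partial_sum Xs n \<omega>
          \<le> \<sigma> * sqrt (pi\<^sup>2 * real n / (8 * \<psi> (real n)))}) summable_on {1::nat..}"
    by (intro summable_on_cong) (simp add: P_def stays_eq_max critical_radius_def)
  ultimately show ?thesis unfolding w_def by simp
qed

end
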